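(* Let $p \equiv 3 \pmod{4}$ be a prime and let $a,b$ be integers. If $p \nmid ab$, then \[ \big|\operatorname{Re} K(a,b,p,\tfrac{p-1}{2})\big| \leq \sqrt{p}, \qquad \big|\operatorname{Im} K(a,b,p,\tfrac{p-1}{2})\big| \leq \sqrt{p}. \] If $a\equiv 0 \pmod p$ and $p\nmid b$, then $K(a,b,p,\tfrac{p-1}{2}) = \tfrac{1}{2}\big( \big( \tfrac{b}{p}\big) i\sqrt{p} - 1\big)$; and if $a\equiv b\equiv 0\pmod p$, then $K(a,b,p,\tfrac{p-1}{2})=\tfrac{p-1}{2}$.
   Context: Let $e(x)=\exp(2\pi i x)$. For a prime $p$ and a positive divisor $d$ of $p-1$, define $K(a,b,p,d)=\sum_{u\in(\mathbb{Z}/p\mathbb{Z})^\times,\ u^d=1} e\big(\frac{au+bu^{-1}}{p}\big)$, where $u^{-1}$ is the inverse of $u$ modulo $p$. $\big(\frac{b}{p}\big)$ is the Legendre symbol. *)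

theory Defs
  imports Complex_Main "HOL-Number_Theory.Number_Theory"
begin

definition e :: "real \<Rightarrow> complex" where
  "e x = exp (2 * of_real pi * \<i> * of_real x)"

text \<open>
  The units of the ring of integers modulo p are represented by the integers u with
  0 \<le> u < p that are coprime to p; the summand depends only on the class of u modulo p.
\<close>

definition K :: "int \<Rightarrow> int \<Rightarrow> nat \<Rightarrow> nat \<Rightarrow> complex" where
  "K a b p d =
     (\<Sum>u \<in> {u \<in> {0..<int p}. coprime u (int p) \<and> [u ^ d = 1] (mod int p)}.
        e (real_of_int (a * u + b * modular_inverse (int p) u) / real p))"

end

theory Submission
  imports Defs "HOL-Algebra.Algebraic_Closure_Type" "Berlekamp_Zassenhaus.Finite_Field"
begin

hide_const (open) Divisibility.prime

text \<open>
  The exponent (p - 1)/2 restricts the sum to the quadratic residues. As -1 is a nonresidue, 2 Re K is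
  the full Kloosterman sum and 2 i Im K is the Salie sum, twisted by the quadratic character.

  \<^item> The Salie sum is a Gauss sum times the sum of two roots of unity, or it vanishes. The
    sign of the Gauss sum comes from Gauss's product formula for alternating sums of q-binomials.

  \<^item> For the Kloosterman sums S(n) over the field with p^n elements, grouping by trace and norm gives
    S(2n) = 2 p^n - S(n)^2. If S(1) exceeded 2 sqrt p, then S(2^k) / sqrt (p^(2^k)) would be unbounded
    in k. So it is enough to bound S(2m) by a constant times p^m, for which Stepanov's method is used:
    few x over the field with p^(2m) elements satisfy Tr (a x + b/x) = c, because they are all roots of
    one nonzero polynomial of small degree.
\<close>

section \<open>Finite fields inside an algebraically closed field\<close>

text \<open>The extension degree has to vary inside a proof, along powers of 2, but a type cannot.
  Hence all finite fields of characteristic p are fixed-point sets of Frobenius powers in one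
  algebraically closed field. The doubling identity holds because a monic quadratic with nonzero
  constant term over a finite field either splits, and is counted by the square of the sum, or has
  conjugate roots in the quadratic extension, and is counted by the sum there; a double root is
  counted once by each. With t = |S| / sqrt q it gives t' \<ge> t^2 - 2, whose repelling fixed point
  2 is the Weil constant: a crude bound uniform in the degree improves to the sharp one. Even degree
  suits Stepanov's method: with R = p^m the map x -> x^R is an involution of the field with R^2
  elements and exchanges the two halves of the trace. So the R-th power of the auxiliary polynomial
  reduces to small degree on the points in question, and simple zeros suffice. The method yields
  upper bounds for the counts only; the known total of the counts over all c makes up for the
  missing lower bounds.\<close>

lemma card_roots_separable:
  fixes f :: "'a :: alg_closed_field poly"
  assumes nz: "f \<noteq> 0" and sep: "\<And>x. poly f x = 0 \<Longrightarrow> poly (pderiv f) x \<noteq> 0"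
  shows "card {x. poly f x = 0} = degree f"
proof -
  obtain A where A: "size A = degree f" "f = smult (lead_coeff f) (\<Prod>x\<in>#A. [:-x, 1:])"
    using alg_closed_imp_factorization[OF nz] by blast
  have "proots f = proots (\<Prod>x\<in>#A. [:-x, 1:])"
    using nz by (subst A(2)) simp
  also have "\<dots> = A"
  proof (induction A)
    case (add x A)
    have "(\<Prod>x\<in>#A. [:-x, 1:]) \<noteq> 0" by (induction A) (auto simp del: mult_pCons_left)
    with add show ?case by (simp add: proots_mult del: mult_pCons_left)
  qed simp
  finally have roots: "proots f = A" .
  have "order x f = 1" if x: "poly f x = 0" for x
  proof (rule ccontr)
    assume "order x f \<noteq> 1"
    with x nz have "order x f \<ge> 2"
      by (metis One_nat_def less_2_cases not_less order_root)
    then have "[:-x, 1:] ^ 2 dvd f"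
      using nz by (simp add: order_divides)
    then obtain g where "f = [:-x, 1:] * ([:-x, 1:] * g)"
      unfolding power2_eq_square by (metis dvdE mult.assoc)
    then have "poly (pderiv f) x = 0"
      by (simp add: pderiv_mult pderiv_pCons del: mult_pCons_left)
    with sep[OF x] show False ..
  qed
  then have "size (proots f) = (\<Sum>x\<in>set_mset (proots f). 1)"
    unfolding size_multiset_overloaded_eq by (intro sum.cong) (use nz in auto)
  moreover have "set_mset (proots f) = {x. poly f x = 0}" using nz by simp
  ultimately show ?thesis using A(1) by (simp add: roots)
qed

locale closed_field_char =
  fixes p :: nat and ty :: "'a :: alg_closed_field itself"
  assumes prime_p: "prime p" and CHAR_p: "CHAR('a) = p"
begin

lemma p_gt_1: "p > 1" and p_pos: "p > 0"
  using prime_p prime_gt_1_nat prime_gt_0_nat by auto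

definition Fq :: "nat \<Rightarrow> 'a set" where "Fq n = {x. x ^ (p ^ n) = x}"

definition Tr :: "nat \<Rightarrow> 'a \<Rightarrow> 'a" where "Tr n x = (\<Sum>i<n. x ^ (p ^ i))"

lemma frob_add: "(x + y) ^ (p ^ n) = x ^ (p ^ n) + (y::'a) ^ (p ^ n)"
  by (rule freshmans_dream') (simp_all add: CHAR_p prime_p)

lemma frob_sum: "(sum f A :: 'a) ^ (p ^ n) = (\<Sum>i\<in>A. f i ^ (p ^ n))"
  by (rule freshmans_dream_sum') (simp_all add: CHAR_p prime_p)

lemma frob_minus: "(- x) ^ (p ^ n) = - ((x::'a) ^ (p ^ n))"
  using frob_add[of x "-x" n] p_pos by (simp add: power_0_left eq_neg_iff_add_eq_0 add.commute)

lemma frob_diff: "(x - y) ^ (p ^ n) = x ^ (p ^ n) - (y::'a) ^ (p ^ n)"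
  using frob_add[of x "-y" n] by (simp add: frob_minus)

lemma Fq_0: "0 \<in> Fq n" and Fq_1: "1 \<in> Fq n"
  using p_pos by (auto simp: Fq_def power_0_left)

lemma Fq_add: "x \<in> Fq n \<Longrightarrow> y \<in> Fq n \<Longrightarrow> x + y \<in> Fq n"
  and Fq_minus: "x \<in> Fq n \<Longrightarrow> - x \<in> Fq n"
  and Fq_diff: "x \<in> Fq n \<Longrightarrow> y \<in> Fq n \<Longrightarrow> x - y \<in> Fq n"
  and Fq_mult: "x \<in> Fq n \<Longrightarrow> y \<in> Fq n \<Longrightarrow> x * y \<in> Fq n"
  and Fq_divide: "x \<in> Fq n \<Longrightarrow> y \<in> Fq n \<Longrightarrow> x / y \<in> Fq n"
  and Fq_power: "x \<in> Fq n \<Longrightarrow> x ^ k \<in> Fq n"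
  by (auto simp: Fq_def frob_add frob_minus frob_diff power_mult_distrib power_divide)
     (metis mult.commute power_mult)

lemma Fq_sum: "(\<And>i. i \<in> I \<Longrightarrow> f i \<in> Fq n) \<Longrightarrow> sum f I \<in> Fq n"
  by (induction I rule: infinite_finite_induct) (auto intro: Fq_add Fq_0)

lemmas Fq_intros = Fq_0 Fq_1 Fq_add Fq_minus Fq_diff Fq_mult Fq_divide Fq_power Fq_sum

lemma Fq_dvd:
  assumes "x \<in> Fq m" "m dvd n"
  shows "x \<in> Fq n"
proof -
  have "x ^ (p ^ (m * k)) = x" for k
  proof (induction k)
    case (Suc k)
    have "x ^ (p ^ (m * Suc k)) = (x ^ (p ^ m)) ^ (p ^ (m * k))"
      by (simp add: power_add flip: power_mult)
    with Suc assms(1) show ?case by (simp add: Fq_def)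
  qed simp
  with assms(2) show ?thesis by (auto simp: Fq_def dvd_def)
qed

lemma Fq1_pow: "x \<in> Fq 1 \<Longrightarrow> x ^ (p ^ n) = x"
  using Fq_dvd[of x 1 n] by (simp add: Fq_def)

text \<open>In characteristic p the derivative of X^(p^n) - X is the constant -1, so all its roots
  in the algebraically closed field are simple and there are p^n of them.\<close>

lemma card_Fq:
  assumes "n > 0"
  shows "card (Fq n) = p ^ n"
proof -
  let ?f = "monom 1 (p ^ n) - [:0, 1 :: 'a:]"
  have "1 < p ^ n" using one_less_power[OF p_gt_1] assms by blast
  then have deg: "degree ?f = p ^ n"
    by (intro antisym degree_le le_degree)
       (use p_pos assms in \<open>auto simp: coeff_pCons split: nat.splits if_splits\<close>)
  have "of_nat (p ^ n) = (0::'a)"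
    using assms by (simp add: of_nat_eq_0_iff_char_dvd CHAR_p dvd_power del: of_nat_power)
  then have "pderiv ?f = -1"
    by (simp add: pderiv_diff pderiv_monom pderiv_pCons one_pCons del: of_nat_power)
  moreover have "?f \<noteq> 0" using deg p_pos by (metis degree_0 power_not_zero less_not_refl2)
  ultimately have "card {x. poly ?f x = 0} = degree ?f"
    by (intro card_roots_separable) auto
  with deg show ?thesis
    by (simp add: Fq_def poly_monom)
qed

lemma finite_Fq: "n > 0 \<Longrightarrow> finite (Fq n)"
  using card_Fq[of n] p_pos card_gt_0_iff by force

lemma of_int_Fq: "of_int k \<in> Fq n"
proof -
  have *: "of_nat j \<in> Fq n" for j
    by (induction j) (auto intro: Fq_intros)
  show ?thesis
    using *[of "nat k"] Fq_minus[OF *[of "nat (-k)"]] by (cases "k \<ge> 0") auto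
qed

lemma of_int_eq_cong: "of_int k = (of_int l :: 'a) \<longleftrightarrow> [k = l] (mod int p)"
  by (simp add: of_int_eq_iff_cong_CHAR CHAR_p)

lemma bij_of_int: "bij_betw (of_int :: int \<Rightarrow> 'a) {0..<int p} (Fq 1)"
proof -
  have inj: "inj_on (of_int :: int \<Rightarrow> 'a) {0..<int p}"
    by (auto simp: inj_on_def of_int_eq_cong cong_def)
  have "of_int ` {0..<int p} = Fq 1"
  proof (rule card_subset_eq)
    show "card (of_int ` {0..<int p} :: 'a set) = card (Fq 1)"
      using card_image[OF inj] card_Fq[of 1] by simp
  qed (use finite_Fq of_int_Fq in auto)
  with inj show ?thesis by (simp add: bij_betw_def)
qed

lemma Fq1_eq: "Fq 1 = range of_int"
proof
  show "Fq 1 \<subseteq> range of_int"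
    unfolding bij_betw_imp_surj_on[OF bij_of_int, symmetric] by blast
qed (use of_int_Fq in blast)

lemma Tr_0: "Tr n 0 = 0" 
  using p_pos by (simp add: Tr_def power_0_left)

lemma Tr_add: "Tr n (x + y) = Tr n x + Tr n y"
  by (simp add: Tr_def frob_add sum.distrib)

text \<open>Raising to the power p shifts the terms x^(p^i) by one place; the last one becomes x
  again, so the sum is fixed.\<close>

lemma Tr_Fq1:
  assumes "x \<in> Fq n"
  shows "Tr n x \<in> Fq 1"
proof -
  have "Tr n x ^ p = (\<Sum>i<n. x ^ (p ^ Suc i))"
    using frob_sum[of "\<lambda>i. x ^ (p ^ i)" "{..<n}" 1]
    by (simp add: Tr_def mult.commute flip: power_mult)
  also have "\<dots> + x ^ p ^ 0 = (\<Sum>i<Suc n. x ^ (p ^ i))"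
    by (subst sum.lessThan_Suc_shift) simp
  also have "\<dots> = Tr n x + x"
    using assms by (simp add: Tr_def Fq_def)
  finally show ?thesis by (simp add: Fq_def)
qed

lemma Tr_plus: "Tr (m + n) x = Tr m x + Tr n (x ^ (p ^ m))"
  by (induction n) (simp_all add: Tr_def power_add add.assoc flip: power_mult)

lemma Tr_pow: "Tr n (x ^ (p ^ m)) = Tr n x ^ (p ^ m)"
  by (simp add: Tr_def frob_sum mult.commute flip: power_mult)

text \<open>As a polynomial the trace has degree at most p^(n-1), and it is nonzero since the
  coefficient of X is 1. It therefore has too few roots to vanish on all p^n elements.\<close>

lemma exists_Tr_nz:
  assumes "n > 0"
  shows "\<exists>z \<in> Fq n. Tr n z \<noteq> 0"
proof (rule ccontr)
  assume "\<not> ?thesis"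
  then have "Fq n \<subseteq> {x. poly (\<Sum>i<n. monom 1 (p ^ i)) x = (0::'a)}"
    by (auto simp: Tr_def poly_sum poly_monom)
  moreover have nz: "(\<Sum>i<n. monom (1::'a) (p ^ i)) \<noteq> 0"
  proof
    assume "(\<Sum>i<n. monom (1::'a) (p ^ i)) = 0"
    then have "coeff (\<Sum>i<n. monom (1::'a) (p ^ i)) 1 = 0" by simp
    moreover have "coeff (\<Sum>i<n. monom (1::'a) (p ^ i)) 1 = (\<Sum>i\<in>{0::nat}. 1)"
      unfolding coeff_sum coeff_monom
      by (rule sum.mono_neutral_cong_right) (use assms p_gt_1 in \<open>auto\<close>)
    ultimately show False by simp
  qed
  ultimately have "card (Fq n) \<le> card {x. poly (\<Sum>i<n. monom 1 (p ^ i)) x = (0::'a)}"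
    by (intro card_mono poly_roots_finite)
  also have "\<dots> \<le> degree (\<Sum>i<n. monom (1::'a) (p ^ i))"
    by (rule Polynomial.card_poly_roots_bound[OF nz])
  also have "\<dots> \<le> p ^ (n - 1)"
    by (intro degree_sum_le) (use p_gt_1 in \<open>auto intro!: order.trans[OF degree_monom_le] power_increasing\<close>)
  also have "\<dots> < p ^ n" using assms p_gt_1 by simp
  finally show False using card_Fq[OF assms] by simp
qed

end

section \<open>Kloosterman sums and quadratic extensions\<close>

lemma e_add: "e (x + y) = e x * e y"
  by (simp add: e_def algebra_simps exp_add)

lemma e_eq_1_iff: "e x = 1 \<longleftrightarrow> x \<in> \<int>"
proof -
  have "e x = cis (2 * pi * x)" by (simp add: e_def cis_conv_exp mult_ac)
  then have "e x = 1 \<longleftrightarrow> cos (2 * pi * x) = 1"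
    by (auto simp: complex_eq_iff dest: cos_one_sin_zero)
  also have "\<dots> \<longleftrightarrow> (\<exists>n::int. x = of_int n)" by (auto simp: cos_one_2pi_int)
  also have "\<dots> \<longleftrightarrow> x \<in> \<int>" by (auto simp: Ints_def)
  finally show ?thesis .
qed

lemma norm_e [simp]: "norm (e x) = 1" by (simp add: e_def)

lemma e_div_eq_1_iff:
  assumes "p > 0"
  shows "e (real_of_int k / real p) = 1 \<longleftrightarrow> int p dvd k"
proof -
  have "real_of_int k / real p \<in> \<int> \<longleftrightarrow> int p dvd k"
  proof
    assume "real_of_int k / real p \<in> \<int>"
    then obtain m where "real_of_int k / real p = of_int m" by (elim Ints_cases)
    then have "real_of_int k = of_int (m * int p)" using assms by (simp add: field_simps)
    then show "int p dvd k" by (metis dvd_triv_right of_int_eq_iff)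
  qed (use assms in auto)
  then show ?thesis by (simp add: e_eq_1_iff)
qed

text \<open>
  The character sending the image of the integer k to e(k/p), where p is the characteristic.
  Outside the prime field its value is unspecified.
\<close>
definition psi :: "'a::ring_1 \<Rightarrow> complex" where
  "psi x = e (real_of_int (SOME k. of_int k = x) / real CHAR('a))"

lemma psi_of_int:
  assumes "CHAR('a::ring_1) > 0"
  shows "psi (of_int k :: 'a) = e (real_of_int k / real CHAR('a))"
proof -
  let ?p = "CHAR('a)"
  define l where "l = (SOME l. of_int l = (of_int k :: 'a))"
  have "of_int l = (of_int k :: 'a)" unfolding l_def by (rule someI) (rule refl)
  then have "[l = k] (mod int ?p)" using of_int_eq_iff_cong_CHAR by blast
  then have "int ?p dvd (l - k)" by (rule iffD1[OF cong_iff_dvd_diff])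
  then have "e (real_of_int (l - k) / real ?p) = 1" by (simp only: e_div_eq_1_iff[OF assms])
  moreover have "e (real_of_int l / real ?p) = e (real_of_int (l - k) / real ?p) * e (real_of_int k / real ?p)"
    unfolding e_add[symmetric] add_divide_distrib[symmetric] by simp
  ultimately show ?thesis by (simp add: psi_def l_def)
qed

lemma norm_psi [simp]: "norm (psi x) = 1" by (simp add: psi_def)

lemma psi_add_of_int:
  assumes "CHAR('a::ring_1) > 0"
  shows "psi (of_int k + of_int l :: 'a) = psi (of_int k :: 'a) * psi (of_int l :: 'a)"
  unfolding of_int_add[symmetric] psi_of_int[OF assms] by (simp add: add_divide_distrib e_add)

lemma psi_of_int_eq_1_iff:
  assumes "CHAR('a::ring_1) > 0"
  shows "psi (of_int k :: 'a) = 1 \<longleftrightarrow> (of_int k :: 'a) = 0"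
proof -
  have "(of_int k :: 'a) = of_int 0 \<longleftrightarrow> [k = 0] (mod int CHAR('a))"
    by (rule of_int_eq_iff_cong_CHAR)
  then show ?thesis
    unfolding psi_of_int[OF assms] e_div_eq_1_iff[OF assms] by (simp only: of_int_0 cong_0_iff)
qed

context closed_field_char
begin

section \<open>Quadratics over a finite field and the doubling identity\<close>

lemma quadratic_splits:
  fixes s r :: 'a
  obtains u v where "u + v = s" "u * v = r"
proof -
  obtain u where "poly [:r, -s, 1:] u = 0"
    using alg_closed_imp_poly_has_root[of "[:r, -s, 1:]"] by auto
  then have "r = u * (s - u)" by (simp add: algebra_simps add_eq_0_iff2)
  then have "u + (s - u) = s" "u * (s - u) = r" by simp_all
  then show ?thesis by (rule that)
qed

text \<open>Let u and v be the roots of X^2 - s X + r and q = p^n. Frobenius x -> x^q permutes them.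
  If it swaps two distinct roots, the counts are 0 and 2; if it fixes two distinct roots, they are 2
  and 0; if u = v, both counts are 1.\<close>

lemma norm_trace_fibre:
  assumes n: "n > 0" and s: "s \<in> Fq n" and r: "r \<in> Fq n"
  shows "card {z \<in> Fq n \<times> Fq n. fst z + snd z = s \<and> fst z * snd z = r} +
         card {x \<in> Fq (2 * n). x + x ^ (p ^ n) = s \<and> x * x ^ (p ^ n) = r} = 2"
proof -
  obtain u v where uv: "u + v = s" "u * v = r" by (rule quadratic_splits)
  let ?q = "p ^ n"
  have roots: "(x = u \<and> y = v) \<or> (x = v \<and> y = u)" if "x + y = s" "x * y = r" for x y
  proof -
    have "(x - u) * (x - v) = x * (x - (u + v)) + u * v" by (simp add: algebra_simps)
    also have "\<dots> = x * (x - (x + y)) + x * y" by (simp only: uv that)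
    also have "\<dots> = 0" by (simp add: algebra_simps)
    finally have "x = u \<or> x = v" by simp
    with that uv show ?thesis by auto
  qed
  have frob2: "x ^ (p ^ (2 * n)) = (x ^ ?q) ^ ?q" for x :: 'a
    by (simp add: mult_2 power_add flip: power_mult)
  have pow_uv: "u ^ ?q + v ^ ?q = s" "u ^ ?q * v ^ ?q = r"
    using s r by (auto simp flip: uv frob_add power_mult_distrib simp: Fq_def)
  have fst: "{z \<in> Fq n \<times> Fq n. fst z + snd z = s \<and> fst z * snd z = r} =
      (if u \<in> Fq n \<and> v \<in> Fq n then {(u, v), (v, u)} else {})" (is "?A = ?B")
  proof
    show "?A \<subseteq> ?B"
    proof
      fix z assume z: "z \<in> ?A"
      then have "fst z + snd z = s" "fst z * snd z = r" by auto
      from roots[OF this] z show "z \<in> ?B" by (cases z) auto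
    qed
    have "v + u = s" "v * u = r" using uv by (simp_all add: add.commute mult.commute)
    with uv show "?B \<subseteq> ?A" by simp
  qed
  have snd: "{x \<in> Fq (2 * n). x + x ^ ?q = s \<and> x * x ^ ?q = r} =
      (if u ^ ?q = v \<and> v ^ ?q = u then {u, v} else {})" (is "?A = ?B")
  proof
    show "?A \<subseteq> ?B"
    proof
      fix x assume "x \<in> ?A"
      then have x: "(x ^ ?q) ^ ?q = x" "x + x ^ ?q = s" "x * x ^ ?q = r"
        by (auto simp: Fq_def frob2)
      from roots[OF x(2,3)] x(1) show "x \<in> ?B" by auto
    qed
    have "v + u = s" "v * u = r" using uv by (simp_all add: add.commute mult.commute)
    with uv show "?B \<subseteq> ?A" by (simp add: Fq_def frob2 mult.commute[of n 2])
  qed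
  show ?thesis
  proof (cases "u ^ ?q = u")
    case True
    then have "v ^ ?q = v" using pow_uv uv by auto
    with True have "u \<in> Fq n" "v \<in> Fq n" by (simp_all add: Fq_def)
    with True show ?thesis unfolding fst snd by (cases "u = v") simp_all
  next
    case False
    with roots[OF pow_uv] have "u ^ ?q = v" "v ^ ?q = u" by auto
    moreover from False have "u \<notin> Fq n" by (simp add: Fq_def)
    moreover from \<open>u ^ ?q = v\<close> False have "u \<noteq> v" by simp
    ultimately show ?thesis unfolding fst snd by simp
  qed
qed

lemma CHAR_pos: "CHAR('a) > 0"
  using CHAR_p p_pos by simp

lemma psi_add:
  assumes "x \<in> Fq 1" "y \<in> Fq 1"
  shows "psi (x + y) = psi x * psi y"
proof -
  obtain k l where "x = of_int k" "y = of_int l" using assms unfolding Fq1_eq by blast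
  then show ?thesis by (simp only: psi_add_of_int[OF CHAR_pos])
qed

lemma psi_eq_1_iff:
  assumes "x \<in> Fq 1"
  shows "psi x = 1 \<longleftrightarrow> x = 0"
proof -
  obtain k where "x = of_int k" using assms unfolding Fq1_eq by blast
  then show ?thesis by (simp only: psi_of_int_eq_1_iff[OF CHAR_pos])
qed

text \<open>Orthogonality of characters: for nonzero c, translating s by a w with Tr (w c) nonzero
  multiplies the sum by a number other than 1.\<close>

lemma sum_psi_Tr:
  assumes n: "n > 0" and c: "c \<in> Fq n"
  shows "(\<Sum>s\<in>Fq n. psi (Tr n (s * c))) = (if c = 0 then of_nat (p ^ n) else 0)"
proof (cases "c = 0")
  case True
  have "psi (0 :: 'a) = 1" by (rule iffD2[OF psi_eq_1_iff[OF Fq_0]]) simp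
  with True show ?thesis by (simp add: Tr_0 card_Fq[OF n])
next
  case False
  obtain z where z: "z \<in> Fq n" "Tr n z \<noteq> 0" using exists_Tr_nz[OF n] by auto
  define w where "w = z / c"
  have w: "w \<in> Fq n" "Tr n (w * c) \<noteq> 0" using z c False by (auto simp: w_def intro: Fq_intros)
  let ?S = "\<Sum>s\<in>Fq n. psi (Tr n (s * c))"
  have "?S = (\<Sum>s\<in>Fq n. psi (Tr n ((s + w) * c)))"
    by (rule sum.reindex_bij_witness[of _ "\<lambda>s. s + w" "\<lambda>s. s - w"]) (use w in \<open>auto intro: Fq_intros\<close>)
  also have "\<dots> = ?S * psi (Tr n (w * c))"
    unfolding sum_distrib_right
    by (rule sum.cong) (use w c in \<open>auto simp: distrib_right Tr_add intro!: psi_add Tr_Fq1 intro: Fq_intros\<close>)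
  finally have "?S * (psi (Tr n (w * c)) - 1) = 0" by (simp add: algebra_simps)
  moreover have "psi (Tr n (w * c)) \<noteq> 1" 
    using w c psi_eq_1_iff[OF Tr_Fq1[OF Fq_mult[OF w(1) c]]] by blast
  ultimately show ?thesis using False by simp
qed

definition kl :: "nat \<Rightarrow> 'a \<Rightarrow> 'a \<Rightarrow> complex" where
  "kl n a b = (\<Sum>x\<in>Fq n - {0}. psi (Tr n (a * x + b / x)))"

text \<open>With s = x + y and r = x y, the sum of a z + b/z over z = x, y equals s (a + b/r). The
  same holds for the conjugate pair x, x^q, so both sums weight the pair (s, r) by the same
  \<open>h\<close>, and \<open>norm_trace_fibre\<close> says that together they meet every pair
  exactly twice.\<close>

lemma kl_double:
  assumes n: "n > 0" and a: "a \<in> Fq n" "a \<noteq> 0" and b: "b \<in> Fq n" "b \<noteq> 0"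
  shows "kl (2 * n) a b = 2 * of_nat (p ^ n) - kl n a b ^ 2"
proof -
  let ?q = "p ^ n"
  define R where "R = Fq n \<times> (Fq n - {0})"
  define h where "h = (\<lambda>(s, r). psi (Tr n (s * (a + b / r))))"
  define P where "P = (Fq n - {0}) \<times> (Fq n - {0})"
  define g where "g = (\<lambda>(x::'a, y). (x + y, x * y))"
  define D where "D = Fq (2 * n) - {0}"
  define f where "f = (\<lambda>x::'a. (x + x ^ ?q, x * x ^ ?q))"
  have fin: "finite R" "finite P" "finite D"
    using n by (auto simp: R_def P_def D_def finite_Fq)
  have frob2: "x ^ (p ^ (2 * n)) = (x ^ ?q) ^ ?q" for x :: 'a
    by (simp add: mult_2 power_add flip: power_mult)
  have gP: "g ` P \<subseteq> R" by (auto simp: g_def P_def R_def intro: Fq_intros)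
  have "(x ^ ?q) ^ ?q = x" if "x \<in> Fq (2 * n)" for x
    using that unfolding Fq_def frob2 by simp
  then have fD: "f ` D \<subseteq> R"
    by (auto simp: f_def D_def R_def Fq_def[of n] frob_add power_mult_distrib add.commute mult.commute)
  have "kl n a b ^ 2 = (\<Sum>z\<in>P. psi (Tr n (a * fst z + b / fst z)) * psi (Tr n (a * snd z + b / snd z)))"
    by (simp add: kl_def power2_eq_square sum_product sum.cartesian_product P_def case_prod_beta)
  also have "\<dots> = (\<Sum>z\<in>P. h (g z))"
  proof (rule sum.cong)
    fix z assume "z \<in> P"
    then obtain x y where z: "z = (x, y)" "x \<in> Fq n" "y \<in> Fq n" "x \<noteq> 0" "y \<noteq> 0" by (auto simp: P_def)
    have "h (g z) = psi (Tr n ((a * x + b / x) + (a * y + b / y)))"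
      using z by (simp add: h_def g_def) (simp add: field_simps)
    also have "\<dots> = psi (Tr n (a * x + b / x)) * psi (Tr n (a * y + b / y))"
      unfolding Tr_add[of n "a * x + b / x"] using z a b by (intro psi_add Tr_Fq1 Fq_intros)
    finally show "psi (Tr n (a * fst z + b / fst z)) * psi (Tr n (a * snd z + b / snd z)) = h (g z)"
      using z by simp
  qed simp
  also have "\<dots> = (\<Sum>t\<in>R. of_nat (card {z \<in> P. g z = t}) * h t)"
    by (rule sum_fun_comp) (use fin gP in auto)
  finally have sq: "kl n a b ^ 2 = (\<Sum>t\<in>R. of_nat (card {z \<in> P. g z = t}) * h t)" .
  have "kl (2 * n) a b = (\<Sum>x\<in>D. h (f x))"
    unfolding kl_def D_def
  proof (rule sum.cong)
    fix x assume x: "x \<in> Fq (2 * n) - {0}"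
    have ab: "a ^ ?q = a" "b ^ ?q = b" using a b by (auto simp: Fq_def)
    \<comment> \<open>Transitivity of the trace: the trace in degree 2n is \<open>Tr n\<close> of
      the relative trace y + y^q.\<close>
    have "Tr (2 * n) (a * x + b / x) = Tr n (a * x + b / x + (a * x + b / x) ^ ?q)"
      unfolding mult_2 Tr_plus by (rule Tr_add[symmetric])
    also have "a * x + b / x + (a * x + b / x) ^ ?q = (x + x ^ ?q) * (a + b / (x * x ^ ?q))"
      using x ab by (simp add: frob_add power_mult_distrib power_divide) (simp add: field_simps)
    finally show "psi (Tr (2 * n) (a * x + b / x)) = h (f x)"
      by (simp add: h_def f_def)
  qed simp
  also have "\<dots> = (\<Sum>t\<in>R. of_nat (card {x \<in> D. f x = t}) * h t)"
    by (rule sum_fun_comp) (use fin fD in auto)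
  finally have "kl n a b ^ 2 + kl (2 * n) a b =
      (\<Sum>t\<in>R. of_nat (card {z \<in> P. g z = t} + card {x \<in> D. f x = t}) * h t)"
    by (simp add: sq distrib_right sum.distrib)
  also have "\<dots> = (\<Sum>t\<in>R. 2 * h t)"
  proof (rule sum.cong)
    fix t assume "t \<in> R"
    then obtain s r where t: "t = (s, r)" "s \<in> Fq n" "r \<in> Fq n" "r \<noteq> 0" by (auto simp: R_def)
    have 1: "{z \<in> P. g z = t} = {z \<in> Fq n \<times> Fq n. fst z + snd z = s \<and> fst z * snd z = r}"
      using t by (auto simp: P_def g_def)
    have 2: "{x \<in> D. f x = t} = {x \<in> Fq (2 * n). x + x ^ ?q = s \<and> x * x ^ ?q = r}"
      using t by (auto simp: D_def f_def)
    have 3: "card {z \<in> P. g z = t} + card {x \<in> D. f x = t} = 2"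
      unfolding 1 2 by (rule norm_trace_fibre[OF n t(2,3)])
    show "of_nat (card {z \<in> P. g z = t} + card {x \<in> D. f x = t}) * h t = 2 * h t"
      unfolding 3 by simp
  qed simp
  also have "\<dots> = 2 * (\<Sum>t\<in>R. h t)" by (simp add: sum_distrib_left)
  \<comment> \<open>For fixed r the sum over s is a full character sum, so only r = -b/a survives;
    it is nonzero because b is.\<close>
  also have "(\<Sum>t\<in>R. h t) = (\<Sum>r\<in>Fq n - {0}. \<Sum>s\<in>Fq n. psi (Tr n (s * (a + b / r))))"
    unfolding R_def h_def by (subst sum.swap) (simp add: sum.cartesian_product)
  also have "\<dots> = (\<Sum>r\<in>Fq n - {0}. if r = - b / a then of_nat (p ^ n) else 0)"
  proof (rule sum.cong)
    fix r assume r: "r \<in> Fq n - {0}"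
    have "a + b / r = 0 \<longleftrightarrow> r = - b / a" using r a by (auto simp: field_simps add_eq_0_iff2)
    then show "(\<Sum>s\<in>Fq n. psi (Tr n (s * (a + b / r)))) = (if r = - b / a then of_nat (p ^ n) else 0)"
      using r a b by (subst sum_psi_Tr[OF n]) (auto intro!: Fq_intros)
  qed simp
  also have "\<dots> = of_nat (p ^ n)"
    using a b n by (subst sum.delta) (auto simp: finite_Fq Fq_minus Fq_divide)
  finally show ?thesis by (simp add: algebra_simps)
qed

end

section \<open>Stepanov's method\<close>

lemma sum_smult_nonzero_if_degrees_distinct:
  fixes v :: "nat \<Rightarrow> 'a :: idom" and t :: "nat \<Rightarrow> 'a poly"
  assumes t: "\<And>N. N < M \<Longrightarrow> t N \<noteq> 0" "\<And>N. N < M \<Longrightarrow> degree (t N) = N + k"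
    and v: "N < M" "v N \<noteq> 0"
  shows "(\<Sum>N<M. smult (v N) (t N)) \<noteq> 0"
proof -
  define L where "L = Max {N. N < M \<and> v N \<noteq> 0}"
  have fin: "finite {N. N < M \<and> v N \<noteq> 0}" by simp
  have L: "L < M" "v L \<noteq> 0"
    using Max_in[OF fin] v unfolding L_def by blast+
  have max: "N \<le> L" if "N < M" "v N \<noteq> 0" for N
    unfolding L_def using fin that by (intro Max_ge) auto
  have "coeff (\<Sum>N<M. smult (v N) (t N)) (L + k) = (\<Sum>N<M. v N * coeff (t N) (L + k))"
    by (simp add: coeff_sum)
  also have "\<dots> = (\<Sum>N\<in>{L}. v N * coeff (t N) (L + k))"
  proof (rule sum.mono_neutral_right)
    show "\<forall>N\<in>{..<M} - {L}. v N * coeff (t N) (L + k) = 0"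
    proof
      fix N assume N: "N \<in> {..<M} - {L}"
      show "v N * coeff (t N) (L + k) = 0"
      proof (cases "v N = 0")
        case False
        with max[of N] N have "N < L" by auto
        with t(2)[of N] N show ?thesis by (simp add: coeff_eq_0)
      qed simp
    qed
  qed (use L in auto)
  also have "\<dots> = v L * lead_coeff (t L)" using t(2)[OF L(1)] by simp
  also have "\<dots> \<noteq> 0" using L t(1)[OF L(1)] by simp
  finally show ?thesis by auto
qed

context closed_field_char
begin

text \<open>Pigeonhole in place of linear algebra: p^M coefficient vectors map to p^E polynomials,
  so two of them collide and their difference is the solution. Working over the prime field matters
  because the entries of \<open>v\<close> are then fixed by every Frobenius power.\<close>

lemma small_solution:
  fixes g :: "nat \<Rightarrow> 'a poly"
  assumes g: "\<And>N i. N < M \<Longrightarrow> coeff (g N) i \<in> Fq 1" "\<And>N. N < M \<Longrightarrow> degree (g N) < E"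
    and EM: "E < M"
  shows "\<exists>v. (\<forall>N. v N \<in> Fq 1) \<and> (\<exists>N<M. v N \<noteq> 0) \<and> (\<Sum>N<M. smult (v N) (g N)) = 0"
proof -
  define V where "V = {..<M} \<rightarrow>\<^sub>E Fq 1"
  define T where "T = {..<E} \<rightarrow>\<^sub>E Fq 1"
  define f where "f = (\<lambda>v. \<lambda>i\<in>{..<E}. coeff (\<Sum>N<M. smult (v N) (g N)) i)"
  have "f ` V \<subseteq> T"
  proof
    fix y assume "y \<in> f ` V"
    then obtain v where v: "v \<in> V" "y = f v" by blast
    have "coeff (\<Sum>N<M. smult (v N) (g N)) i \<in> Fq 1" for i
      unfolding coeff_sum coeff_smult
      by (intro Fq_sum Fq_mult) (use v g in \<open>auto simp: V_def\<close>)
    then show "y \<in> T" by (auto simp: v f_def T_def)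
  qed
  moreover have "finite T" unfolding T_def by (intro finite_PiE finite_Fq) auto
  ultimately have "card (f ` V) \<le> card T" by (rule card_mono[rotated])
  also have "card T = p ^ E" using card_Fq[of 1] by (simp add: T_def card_PiE)
  also have "\<dots> < p ^ M" using EM p_gt_1 by simp
  also have "p ^ M = card V" using card_Fq[of 1] by (simp add: V_def card_PiE)
  finally have "\<not> inj_on f V" using pigeonhole by blast
  then obtain v w where vw: "v \<in> V" "w \<in> V" "f v = f w" "v \<noteq> w" by (auto simp: inj_on_def)
  define u where "u = (\<lambda>N. if N < M then v N - w N else 0)"
  show ?thesis
  proof (intro exI[of _ u] conjI allI)
    show "u N \<in> Fq 1" for N
      using vw unfolding u_def V_def by (cases "N < M") (auto simp: PiE_def intro!: Fq_diff Fq_0)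
    from vw obtain N where "v N \<noteq> w N" by blast
    moreover from this vw have "N < M" unfolding V_def using PiE_arb by (metis lessThan_iff)
    ultimately show "\<exists>N<M. u N \<noteq> 0" by (auto simp: u_def)
    have "(\<Sum>N<M. smult (u N) (g N)) = (\<Sum>N<M. smult (v N) (g N)) - (\<Sum>N<M. smult (w N) (g N))"
      by (simp add: u_def smult_diff_left sum_subtractf)
    also have "\<dots> = 0"
    proof (rule poly_eqI)
      fix i
      show "coeff ((\<Sum>N<M. smult (v N) (g N)) - (\<Sum>N<M. smult (w N) (g N))) i = coeff 0 i"
      proof (cases "i < E")
        case True
        with fun_cong[OF vw(3), of i] show ?thesis by (simp add: f_def)
      next
        case False
        then have "coeff (g N) i = 0" if "N < M" for N
          using g(2)[OF that] by (intro coeff_eq_0) simp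
        then show ?thesis by (simp add: coeff_sum)
      qed
    qed
    finally show "(\<Sum>N<M. smult (u N) (g N)) = 0" .
  qed
qed

text \<open>The main term p^(m-1) * p^m is p^(2m-1), about the average number of solutions per value
  of c. The error term 3 p^m is of the order of the square root of the field size.\<close>

lemma stepanov_bound:
  assumes m: "m > 0" and a: "a \<in> Fq 1" "a \<noteq> 0" and b: "b \<in> Fq 1" and c: "c \<in> Fq 1"
  shows "card {x \<in> Fq (2 * m) - {0}. Tr (2 * m) (a * x + b / x) = c} \<le> (p ^ (m - 1) + 3) * p ^ m"
proof -
  define r where "r = p ^ (m - 1)"
  define R where "R = p ^ m"
  \<comment> \<open>\<open>J\<close> is the number of values of the digit \<open>B N\<close>. The
    number J R of unknowns exceeds \<open>E\<close> by R + r - 2; with r + 1 in place of r + 2 the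
    excess would be r - 1, which is 0 for m = 1.\<close>
  define J where "J = r + 2"
  have R: "R = p * r" using m unfolding R_def r_def by (cases m) auto
  have r_pos: "r > 0" using p_pos by (simp add: r_def)
  have pi_le: "p ^ i \<le> r" if "i < m" for i
    unfolding r_def using that p_gt_1 by (intro power_increasing) auto
  text \<open>
    W is x^r Tr m (a x + b/x) with denominators cleared. The index N has the digits B N, L N, A N in mixed
    radix, chosen so that the N-th basis polynomial h N has degree N + r (p - 1); distinct degrees give
    linear independence. On the set in question Tr m (a x + b/x) ^ R = c - Tr m (a x + b/x) and
    x^(R^2) = x, so the R-th power of a combination of the h N is the same combination of the g N,
    up to a power of x. The g N have degree less than E, which is less than the number of unknowns.
  \<close>
  define W where "W = (\<Sum>i<m. monom a (r + p ^ i) + monom b (r - p ^ i))"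
  define A where "A = (\<lambda>N::nat. N mod r)"
  define B where "B = (\<lambda>N::nat. N div R)"
  define L where "L = (\<lambda>N::nat. (N mod R) div r)"
  have dec: "N = B N * R + L N * r + A N" for N
  proof -
    have "A N = (N mod R) mod r" by (simp add: A_def R mod_mod_cancel)
    then show ?thesis by (simp add: B_def L_def add.assoc)
  qed
  have A_lt: "A N < r" for N using r_pos by (simp add: A_def)
  have L_lt: "L N < p" for N using r_pos p_pos by (simp add: L_def R less_mult_imp_div_less)
  have B_lt: "B N < J" if "N < J * R" for N using that by (simp add: B_def less_mult_imp_div_less)

  have degW: "degree W \<le> 2 * r" unfolding W_def
    by (intro degree_sum_le degree_add_le order.trans[OF degree_monom_le])
       (use pi_le in \<open>fastforce simp: mult_2\<close>)+
  \<comment> \<open>The exponent 2r arises only from i = m - 1, where p^i = r. As a is nonzero, the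
    degree of \<open>W\<close> is exact, and on this rest the distinct degrees of the
    \<open>h N\<close>.\<close>
  have coW: "coeff W (2 * r) = a"
  proof -
    have "coeff W (2 * r) = (\<Sum>i<m. if i = m - 1 then a else 0)"
      unfolding W_def coeff_sum
    proof (rule sum.cong)
      fix i assume i: "i \<in> {..<m}"
      have "r + p ^ i = 2 * r \<longleftrightarrow> i = m - 1"
        using p_gt_1 by (simp add: r_def mult_2)
      moreover have "r - p ^ i \<noteq> 2 * r" using r_pos by simp
      ultimately show "coeff (monom a (r + p ^ i) + monom b (r - p ^ i)) (2 * r) = (if i = m - 1 then a else 0)"
        by simp
    qed simp
    then show ?thesis using m by simp
  qed
  have W: "W \<noteq> 0" "degree W = 2 * r"
    using coW a degW le_degree[of W "2 * r"] by auto

  \<comment> \<open>The last factor serves twice. It makes every \<open>h N\<close> and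
    \<open>g N\<close> carry the same power x^(r (p-1)) when evaluated, and it reduces the weight of
    the digit \<open>L N\<close> in the degree of \<open>h N\<close> from 2r to r, as the mixed
    radix requires.\<close>
  define h where "h = (\<lambda>N. monom 1 (A N + B N * R) * W ^ L N * monom 1 (r * (p - 1 - L N)) :: 'a poly)"
  define g where "g = (\<lambda>N. monom 1 (A N * R + B N) * (monom c r - W) ^ L N * monom 1 (r * (p - 1 - L N)) :: 'a poly)"
  have h: "h N \<noteq> 0" "degree (h N) = N + r * (p - 1)" for N
  proof -
    have [simp]: "monom (1::'a) n \<noteq> 0" for n by simp
    show nz: "h N \<noteq> 0" using W by (simp add: h_def)
    have "degree (h N) = (A N + B N * R) + L N * (2 * r) + r * (p - 1 - L N)"
      using W by (simp add: h_def degree_mult_eq degree_power_eq degree_monom_eq)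
    also have "\<dots> = (B N * R + L N * r + A N) + (r * L N + r * (p - 1 - L N))"
      by simp
    also have "r * L N + r * (p - 1 - L N) = r * (p - 1)"
      using L_lt[of N] by (simp flip: distrib_left)
    finally show "degree (h N) = N + r * (p - 1)" using dec[of N] by simp
  qed
  \<comment> \<open>The three terms bound A N * R, B N, and the degree of the trace factor together
    with its padding.\<close>
  define E where "E = (r - 1) * R + J + 2 * r * (p - 1)"
  have deg_g: "degree (g N) < E" if "N < J * R" for N
  proof -
    have "degree ((monom c r - W) ^ L N) \<le> 2 * r * L N"
      by (rule order.trans[OF degree_power_le])
         (use degW in \<open>auto intro!: mult_right_mono degree_diff_le order.trans[OF degree_monom_le]\<close>)
    then have "degree (g N) \<le> (A N * R + B N) + 2 * r * L N + r * (p - 1 - L N)"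
      unfolding g_def
      by (intro order.trans[OF degree_mult_le] add_mono degree_monom_le)
    also have "\<dots> \<le> A N * R + B N + 2 * r * L N + 2 * r * (p - 1 - L N)" by simp
    also have "\<dots> = A N * R + B N + 2 * r * (p - 1)"
      using L_lt[of N] by (simp add: add.assoc flip: distrib_left)
    also have "A N * R \<le> (r - 1) * R" using A_lt[of N] by (intro mult_right_mono) auto
    finally show ?thesis using B_lt[OF that] by (simp add: E_def)
  qed
  have E_lt: "E < J * R"
  proof -
    have "p \<ge> 2" "r \<ge> 1" using p_gt_1 r_pos by auto
    then obtain p' r' where pr: "p = p' + 2" "r = r' + 1"
      by (metis add.commute le_Suc_ex)
    show ?thesis unfolding E_def J_def R pr by (simp add: algebra_simps)
  qed
  have cW: "coeff W i \<in> Fq 1" for i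
    unfolding W_def by (auto simp: coeff_sum simp del: One_nat_def intro!: Fq_sum Fq_add Fq_0 a b)
  have coeff_mult_Fq: "coeff (f1 * f2) i \<in> Fq 1"
    if "\<And>i. coeff f1 i \<in> Fq 1" "\<And>i. coeff f2 i \<in> Fq 1" for f1 f2 :: "'a poly" and i
    unfolding coeff_mult using that by (intro Fq_sum Fq_mult)
  have coeff_power_Fq: "coeff (f1 ^ n) i \<in> Fq 1"
    if "\<And>i. coeff f1 i \<in> Fq 1" for f1 :: "'a poly" and i n
    by (induction n arbitrary: i) (auto intro!: coeff_mult_Fq that simp: coeff_1 Fq_0 Fq_1 simp del: One_nat_def)
  have coeff_monom_Fq: "coeff (monom x n) i \<in> Fq 1" if "x \<in> Fq 1" for x :: 'a and n i
    using that Fq_0 by simp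
  have g_Fq: "coeff (g N) i \<in> Fq 1" for N i
    unfolding g_def by (intro coeff_mult_Fq coeff_power_Fq coeff_monom_Fq Fq_1)
       (auto simp: coeff_diff simp del: coeff_monom One_nat_def intro!: Fq_diff coeff_monom_Fq c cW)
  have "\<exists>v. (\<forall>N. v N \<in> Fq 1) \<and> (\<exists>N<J * R. v N \<noteq> 0) \<and> (\<Sum>N<J * R. smult (v N) (g N)) = 0"
    by (rule small_solution[OF _ _ E_lt]) (rule g_Fq, rule deg_g)
  then obtain v where v: "\<And>N. v N \<in> Fq 1" "\<exists>N<J * R. v N \<noteq> 0" "(\<Sum>N<J * R. smult (v N) (g N)) = 0"
    by blast
  define H where "H = (\<Sum>N<J * R. smult (v N) (h N))"
  have H: "H \<noteq> 0"
  proof -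
    from v(2) obtain N where N: "N < J * R" "v N \<noteq> 0" by blast
    show ?thesis unfolding H_def 
      by (rule sum_smult_nonzero_if_degrees_distinct[where t = h and v = v and N = N]) (rule h N)+
  qed
  have degH: "degree H \<le> (J + 1) * R"
    unfolding H_def
  proof (intro degree_sum_le)
    fix N assume "N \<in> {..<J * R}"
    moreover have "r * (p - 1) \<le> R" by (simp add: R)
    ultimately show "degree (smult (v N) (h N)) \<le> (J + 1) * R"
      using h(2)[of N] by (intro order.trans[OF degree_smult_le]) (simp add: distrib_right del: One_nat_def)
  qed simp
  have "poly H x = 0" if x: "x \<in> Fq (2 * m)" "x \<noteq> 0" "Tr (2 * m) (a * x + b / x) = c" for x
  proof -
    define t where "t = Tr m (a * x + b / x)"
    have powR: "y ^ R = y" if "y \<in> Fq 1" for y :: 'a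
      unfolding R_def using that by (rule Fq1_pow)
    have xRR: "(x ^ R) ^ R = x"
      using x(1) by (simp add: Fq_def R_def mult_2 power_add flip: power_mult)
    have tR: "t ^ R = c - t"
      using x(3) unfolding mult_2 Tr_plus Tr_pow t_def R_def by (simp add: algebra_simps)
    have t_eq: "t = (\<Sum>i<m. a * x ^ (p ^ i) + b / x ^ (p ^ i))"
      unfolding t_def Tr_def by (simp add: frob_add power_mult_distrib power_divide Fq1_pow[OF a(1)] Fq1_pow[OF b])
    have Wx: "poly W x = x ^ r * t"
      unfolding W_def t_eq poly_sum sum_distrib_left
    proof (rule sum.cong)
      fix i assume "i \<in> {..<m}"
      then have "p ^ i \<le> r" using pi_le by simp
      then show "poly (monom a (r + p ^ i) + monom b (r - p ^ i)) x = x ^ r * (a * x ^ p ^ i + b / x ^ p ^ i)"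
        using x(2) by (simp add: poly_monom power_add power_diff distrib_left)
    qed simp
    have xr: "x ^ (r * L N) * x ^ (r * (p - 1 - L N)) = x ^ (r * (p - 1))" for N
      using L_lt[of N] by (simp flip: power_add distrib_left)
    have hx: "poly (h N) x = x ^ (r * (p - 1)) * (x ^ A N * (x ^ R) ^ B N * t ^ L N)" for N
    proof -
      have "poly (h N) x = x ^ A N * (x ^ R) ^ B N * t ^ L N * (x ^ (r * L N) * x ^ (r * (p - 1 - L N)))"
        unfolding h_def poly_mult poly_power Wx poly_monom
        by (simp add: power_mult_distrib power_add mult.commute[of "B N"] power_mult mult_ac)
      then show ?thesis unfolding xr by (simp only: mult_ac)
    qed
    have gx: "poly (g N) x = x ^ (r * (p - 1)) * ((x ^ R) ^ A N * x ^ B N * (c - t) ^ L N)" for N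
    proof -
      have cW: "poly (monom c r - W) x = x ^ r * (c - t)"
        unfolding poly_diff Wx poly_monom by (simp add: algebra_simps)
      have "poly (g N) x = (x ^ R) ^ A N * x ^ B N * (c - t) ^ L N * (x ^ (r * L N) * x ^ (r * (p - 1 - L N)))"
        unfolding g_def poly_mult poly_power cW poly_monom
        by (simp add: power_mult_distrib power_add mult.commute[of "A N"] power_mult mult_ac)
      then show ?thesis unfolding xr by (simp only: mult_ac)
    qed
    define G0 where "G0 = (\<Sum>N<J * R. v N * ((x ^ R) ^ A N * x ^ B N * (c - t) ^ L N))"
    define H0 where "H0 = (\<Sum>N<J * R. v N * (x ^ A N * (x ^ R) ^ B N * t ^ L N))"
    have "poly (\<Sum>N<J * R. smult (v N) (g N)) x = x ^ (r * (p - 1)) * G0"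
      unfolding G0_def poly_sum sum_distrib_left poly_smult gx by (simp only: mult_ac)
    with v(3) x(2) have G0: "G0 = 0" by simp
    have "H0 ^ R = (\<Sum>N<J * R. (v N * (x ^ A N * (x ^ R) ^ B N * t ^ L N)) ^ R)"
      unfolding H0_def R_def by (rule frob_sum)
    also have "\<dots> = G0"
      unfolding G0_def
    proof (rule sum.cong)
      fix N
      have swap: "(y ^ k) ^ R = (y ^ R) ^ k" for y :: 'a and k
        by (simp add: mult.commute flip: power_mult)
      show "(v N * (x ^ A N * (x ^ R) ^ B N * t ^ L N)) ^ R = v N * ((x ^ R) ^ A N * x ^ B N * (c - t) ^ L N)"
        unfolding power_mult_distrib powR[OF v(1)] swap[of x "A N"] swap[of "x ^ R" "B N"] swap[of t "L N"] xRR tR ..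
    qed simp
    finally have "H0 = 0" using G0 by simp
    moreover have "poly H x = x ^ (r * (p - 1)) * H0"
      unfolding H_def H0_def poly_sum sum_distrib_left poly_smult hx by (simp only: mult_ac)
    ultimately show ?thesis by simp
  qed
  then have "{x \<in> Fq (2 * m) - {0}. Tr (2 * m) (a * x + b / x) = c} \<subseteq> {x. poly H x = 0}" by auto
  then have "card {x \<in> Fq (2 * m) - {0}. Tr (2 * m) (a * x + b / x) = c} \<le> card {x. poly H x = 0}"
    by (intro card_mono poly_roots_finite H)
  also have "\<dots> \<le> degree H" by (rule Polynomial.card_poly_roots_bound[OF H])
  also have "\<dots> \<le> (J + 1) * R" by (rule degH)
  also have "(J + 1) * R = (p ^ (m - 1) + 3) * p ^ m" 
    unfolding J_def R_def r_def by (simp add: algebra_simps)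
  finally show ?thesis .
qed

end

section \<open>The Weil bound\<close>

text \<open>Since t^2 - 4 = (t + 2) (t - 2), an excess of t over 2 grows at least fourfold at each
  step. The bound is asked only from index 1 on, where the degrees are even.\<close>

lemma le_2_if_square_growth_bounded:
  fixes t :: "nat \<Rightarrow> real"
  assumes step: "\<And>k. t (Suc k) \<ge> t k ^ 2 - 2" and bound: "\<And>k. t (Suc k) \<le> C"
  shows "t 0 \<le> 2"
proof (rule ccontr)
  assume "\<not> t 0 \<le> 2"
  then have d: "t 0 - 2 > 0" by simp
  have grow: "t k - 2 \<ge> 4 ^ k * (t 0 - 2)" for k
  proof (induction k)
    case (Suc k)
    have "t k - 2 \<ge> 0" using Suc d by (smt (verit) mult_nonneg_nonneg zero_le_power)
    then have "4 * (t k - 2) \<le> (t k + 2) * (t k - 2)" by (intro mult_right_mono) auto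
    also have "\<dots> \<le> t (Suc k) - 2" using step[of k] by (simp add: algebra_simps power2_eq_square)
    finally show ?case using Suc by simp
  qed simp
  obtain n where "(C - 2) / (t 0 - 2) < 4 ^ n" using real_arch_pow[of 4] by auto
  also have "\<dots> \<le> (4::real) ^ Suc n" by simp
  finally have "C - 2 < 4 ^ Suc n * (t 0 - 2)" using d by (simp add: field_simps)
  with grow[of "Suc n"] bound[of n] show False by simp
qed

context closed_field_char
begin

text \<open>Group the sum by the value c of the trace. The counts \<open>N c\<close> are compared
  with the main term \<open>B\<close>; the upper bound \<open>A\<close> for each count and the total
  of all counts control the sum of the deviations.\<close>

lemma kl_even_bound:
  assumes m: "m > 0" and a: "a \<in> Fq 1" "a \<noteq> 0" and b: "b \<in> Fq 1"
  shows "norm (kl (2 * m) a b) \<le> 7 * real p * real p ^ m"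
proof -
  define X' where "X' = Fq (2 * m) - {0}"
  define N where "N = (\<lambda>c. real (card {x \<in> X'. Tr (2 * m) (a * x + b / x) = c}))"
  define A where "A = (real p ^ (m - 1) + 3) * real p ^ m"
  define B where "B = real p ^ (m - 1) * real p ^ m"
  have ab: "a \<in> Fq (2 * m)" "b \<in> Fq (2 * m)" using a b by (auto intro: Fq_dvd)
  have fin: "finite X'" "finite (Fq 1)" using m by (auto simp: X'_def finite_Fq)
  have im: "(\<lambda>x. Tr (2 * m) (a * x + b / x)) ` X' \<subseteq> Fq 1"
    using ab by (auto simp: X'_def simp del: One_nat_def intro!: Tr_Fq1 Fq_add Fq_mult Fq_divide)
  have N_le: "N c \<le> A" if "c \<in> Fq 1" for c
  proof -
    have "N c \<le> real ((p ^ (m - 1) + 3) * p ^ m)"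
      unfolding N_def X'_def of_nat_le_iff by (rule stepanov_bound[OF m a b that])
    then show ?thesis by (simp add: A_def)
  qed
  have pB: "real p * B = real p ^ (2 * m)"
  proof -
    have "real p * B = (real p ^ (m - 1) * real p) * real p ^ m" by (simp add: B_def)
    also have "\<dots> = real p ^ m * real p ^ m" using m by (simp only: power_minus_mult)
    finally show ?thesis by (simp add: mult_2 power_add)
  qed
  have card1: "card (Fq 1) = p" using card_Fq[of 1] by simp
  have "real (card X') = (\<Sum>x\<in>X'. 1)" by simp
  also have "\<dots> = (\<Sum>c\<in>Fq 1. N c * 1)"
    unfolding N_def by (rule sum_fun_comp[OF fin im])
  finally have sumN: "(\<Sum>c\<in>Fq 1. N c) = real p ^ (2 * m) - 1"
    using card_Fq[of "2 * m"] m Fq_0[of "2 * m"] p_pos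
    by (simp add: X'_def card_Diff_singleton of_nat_diff Suc_leI)
  have "kl (2 * m) a b = (\<Sum>x\<in>X'. psi (Tr (2 * m) (a * x + b / x)))"
    by (simp add: kl_def X'_def)
  also have "\<dots> = (\<Sum>c\<in>Fq 1. of_nat (card {x \<in> X'. Tr (2 * m) (a * x + b / x) = c}) * psi c)"
    by (rule sum_fun_comp[OF fin im])
  \<comment> \<open>Subtracting the constant \<open>B\<close> changes nothing, because the values of
    \<open>psi\<close> on the prime field sum to 0.\<close>
  also have "\<dots> = (\<Sum>c\<in>Fq 1. of_real (N c) * psi c) - of_real B * (\<Sum>c\<in>Fq 1. psi c)"
    using sum_psi_Tr[of 1 1] Fq_1[of 1] by (simp add: N_def Tr_def)
  also have "\<dots> = (\<Sum>c\<in>Fq 1. of_real (N c - B) * psi c)"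
    by (simp add: sum_distrib_left sum_subtractf left_diff_distrib)
  finally have "norm (kl (2 * m) a b) \<le> (\<Sum>c\<in>Fq 1. norm (of_real (N c - B) * psi c))"
    using norm_sum by metis
  \<comment> \<open>From N \<le> A and B \<le> A follows |N - B| \<le> 2 A - B - N. The right side
    is linear in N, so its sum over c needs only the total of the counts.\<close>
  also have "\<dots> \<le> (\<Sum>c\<in>Fq 1. (2 * A - B) - N c)"
  proof (rule sum_mono)
    fix c assume "c \<in> Fq 1"
    have "B \<le> A" by (simp add: A_def B_def distrib_right)
    with N_le[OF \<open>c \<in> Fq 1\<close>] have "\<bar>N c - B\<bar> \<le> (2 * A - B) - N c" by linarith
    then show "norm (of_real (N c - B) * psi c) \<le> (2 * A - B) - N c"
      by (simp only: norm_mult norm_psi norm_of_real mult_1_right)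
  qed
  also have "\<dots> = real p * (2 * A - B) - (real p ^ (2 * m) - 1)"
    unfolding sum_subtractf sumN by (simp only: sum_constant card1 right_diff_distrib)
  \<comment> \<open>What remains is 2 p (A - B) + 1 with A - B = 3 p^m; absorbing the 1 gives the
    constant 7.\<close>
  also have "\<dots> = 6 * real p * real p ^ m + 1"
    unfolding pB[symmetric] by (simp add: A_def B_def algebra_simps)
  also have "1 \<le> real p * real p ^ m"
    using p_pos by (simp flip: power_Suc)
  finally show ?thesis by simp
qed

theorem kl_bound:
  assumes a: "a \<in> Fq 1" "a \<noteq> 0" and b: "b \<in> Fq 1" "b \<noteq> 0"
  shows "norm (kl 1 a b) \<le> 2 * sqrt (real p)"
proof -
  define t where "t = (\<lambda>k. norm (kl (2 ^ k) a b) / sqrt (real p ^ 2 ^ k))"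
  have pn: "real p ^ n > 0" for n using p_pos by simp
  have sqrt2: "sqrt (real p ^ (2 * n)) = real p ^ n" for n
    using p_pos by (simp add: real_sqrt_mult power_add mult_2)
  have "t 0 \<le> 2"
  proof (rule le_2_if_square_growth_bounded)
    fix k
    let ?n = "2 ^ k :: nat"
    have ab: "a \<in> Fq ?n" "b \<in> Fq ?n" using a b by (auto intro: Fq_dvd)
    have "kl (2 * ?n) a b = 2 * of_nat (p ^ ?n) - kl ?n a b ^ 2"
      by (rule kl_double) (use ab a b in auto)
    then have "norm (kl ?n a b ^ 2) - norm (2 * of_nat (p ^ ?n) :: complex) \<le> norm (kl (2 * ?n) a b)"
      by (metis norm_minus_commute norm_triangle_ineq2)
    then have "norm (kl ?n a b) ^ 2 - 2 * real p ^ ?n \<le> norm (kl (2 * ?n) a b)"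
      by (simp add: norm_power norm_mult)
    then have "(norm (kl ?n a b) ^ 2 - 2 * real p ^ ?n) / real p ^ ?n \<le> norm (kl (2 * ?n) a b) / real p ^ ?n"
      using pn by (intro divide_right_mono) (auto simp: less_imp_le)
    moreover have "(norm (kl ?n a b) ^ 2 - 2 * real p ^ ?n) / real p ^ ?n = t k ^ 2 - 2"
      using pn[of ?n] by (simp add: t_def power_divide less_imp_le) (simp add: field_simps)
    moreover have "norm (kl (2 * ?n) a b) / real p ^ ?n = t (Suc k)"
      by (simp only: t_def power_Suc sqrt2)
    ultimately show "t k ^ 2 - 2 \<le> t (Suc k)" by simp
    have "norm (kl (2 * ?n) a b) \<le> 7 * real p * real p ^ ?n"
      by (rule kl_even_bound) (use a b in auto)
    then show "t (Suc k) \<le> 7 * real p"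
      using pn[of ?n] by (simp only: t_def power_Suc sqrt2) (simp add: divide_le_eq)
  qed
  then show ?thesis using p_pos by (simp add: t_def divide_le_eq)
qed

end

section \<open>Gaussian binomials\<close>

text \<open>Gaussian binomials by their Pascal recursion: no division by 1 - q^j occurs, so that q
  may be a root of unity.\<close>

fun qbinom :: "'a::comm_ring_1 \<Rightarrow> nat \<Rightarrow> nat \<Rightarrow> 'a" where
  "qbinom q n 0 = 1"
| "qbinom q 0 (Suc k) = 0"
| "qbinom q (Suc n) (Suc k) = qbinom q n k + q ^ Suc k * qbinom q n (Suc k)"

lemma qbinom_eq_0: "n < k \<Longrightarrow> qbinom q n k = 0"
  by (induction q n k rule: qbinom.induct) auto

text \<open>The ratio of neighbouring Gaussian binomials in a row, cross-multiplied.\<close>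

lemma qbinom_Suc_right:
  "k \<le> n \<Longrightarrow> (1 - q ^ Suc k) * qbinom q n (Suc k) = (1 - q ^ (n - k)) * qbinom q n k"
proof (induction q n k rule: qbinom.induct)
  case (1 q n)
  show ?case
  proof (induction n)
    case (Suc n)
    have "(1 - q ^ Suc 0) * qbinom q (Suc n) (Suc 0) = 1 - q + q * ((1 - q ^ Suc 0) * qbinom q n (Suc 0))"
      by (simp add: algebra_simps)
    then show ?case unfolding Suc by (simp add: algebra_simps)
  qed simp
next
  case (3 q n k)
  then have kn: "k \<le> n" by simp
  let ?A = "qbinom q n k" and ?B = "qbinom q n (Suc k)" and ?C = "qbinom q n (Suc (Suc k))"
  have IH1: "(1 - q ^ Suc k) * ?B = (1 - q ^ (n - k)) * ?A" using 3 kn by simp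
  have IH2: "(1 - q ^ Suc (Suc k)) * ?C = (1 - q ^ (n - Suc k)) * ?B"
  proof (cases "Suc k \<le> n")
    case False
    then show ?thesis by (simp add: qbinom_eq_0)
  qed (use 3 in simp)
  \<comment> \<open>For k = n the difference \<open>n - Suc k\<close> truncates to 0, but then
    \<open>?B\<close> vanishes.\<close>
  have pw: "q ^ Suc k * q ^ (n - Suc k) * ?B = q ^ n * ?B"
  proof (cases "Suc k \<le> n")
    case True
    then have "q ^ Suc k * q ^ (n - Suc k) = q ^ n" by (simp del: power_Suc flip: power_add)
    then show ?thesis by (rule arg_cong)
  qed (simp add: qbinom_eq_0)
  have pw2: "q ^ Suc k * q ^ (n - k) = q ^ Suc n"
    using kn by (simp flip: power_add power_Suc)
  have "(1 - q ^ Suc (Suc k)) * qbinom q (Suc n) (Suc (Suc k))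
        = (1 - q ^ Suc (Suc k)) * ?B + q ^ Suc (Suc k) * ((1 - q ^ Suc (Suc k)) * ?C)"
    by (simp add: algebra_simps)
  also have "\<dots> = (1 - q ^ Suc (Suc k)) * ?B + q * (q ^ Suc k * ?B - q ^ Suc k * q ^ (n - Suc k) * ?B)"
    unfolding IH2 by (simp add: algebra_simps)
  also have "\<dots> = ?B - q ^ Suc n * ?B"
    unfolding pw by (simp add: algebra_simps)
  also have "\<dots> = (1 - q ^ (n - k)) * (?A + q ^ Suc k * ?B)"
  proof -
    have "(1 - q ^ (n - k)) * (?A + q ^ Suc k * ?B)
        = (1 - q ^ Suc k) * ?B + q ^ Suc k * ?B - (q ^ Suc k * q ^ (n - k)) * ?B"
      unfolding distrib_left IH1[symmetric] by (simp add: algebra_simps)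
    also have "\<dots> = ?B - q ^ Suc n * ?B" unfolding pw2 by (simp add: algebra_simps)
    finally show ?thesis ..
  qed
  finally show ?case by simp
qed simp

text \<open>The q-analogue of (n + 1 - k) C(n + 1, k) = (n + 1) C(n, k).\<close>

lemma qbinom_Suc_left:
  "k \<le> Suc n \<Longrightarrow> (1 - q ^ (Suc n - k)) * qbinom q (Suc n) k = (1 - q ^ Suc n) * qbinom q n k"
proof (cases k)
  case (Suc j)
  assume "k \<le> Suc n"
  with Suc have j: "j \<le> n" by simp
  have "q ^ Suc j * q ^ (n - j) = q ^ Suc n" using j by (simp flip: power_add power_Suc)
  moreover have "(1 - q ^ (n - j)) * qbinom q (Suc n) (Suc j) =
      (1 - q ^ (n - j)) * qbinom q n j + (q ^ Suc j - q ^ Suc j * q ^ (n - j)) * qbinom q n (Suc j)"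
    by (simp add: algebra_simps)
  ultimately have "(1 - q ^ (n - j)) * qbinom q (Suc n) (Suc j) =
      (1 - q ^ Suc j) * qbinom q n (Suc j) + (q ^ Suc j - q ^ Suc n) * qbinom q n (Suc j)"
    using qbinom_Suc_right[OF j, of q] by simp
  also have "\<dots> = (1 - q ^ Suc n) * qbinom q n (Suc j)" by (simp add: algebra_simps)
  finally show ?thesis using Suc by simp
qed simp

text \<open>The second Pascal rule; its difference from the defining one is exactly
  \<open>qbinom_Suc_right\<close>.\<close>

lemma qbinom_rec2:
  "k \<le> n \<Longrightarrow> qbinom q (Suc n) (Suc k) = q ^ (n - k) * qbinom q n k + qbinom q n (Suc k)"
  using qbinom_Suc_right[of k n q] by (simp add: algebra_simps)

definition alt_qsum :: "'a::comm_ring_1 \<Rightarrow> nat \<Rightarrow> 'a" where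
  "alt_qsum q n = (\<Sum>k\<le>n. (-1) ^ k * qbinom q n k)"

text \<open>By the second Pascal rule the row n + 1 splits into the row n weighted by q^(n-k) and a
  shifted row n. The shift reverses the sign, so the latter gives back the unweighted alternating
  sum.\<close>

lemma alt_qsum_Suc: "alt_qsum q (Suc n) = (\<Sum>k\<le>n. (-1) ^ k * ((1 - q ^ (n - k)) * qbinom q n k))"
proof -
  have "alt_qsum q (Suc n) = 1 - (\<Sum>k\<le>n. (-1) ^ k * qbinom q (Suc n) (Suc k))"
    unfolding alt_qsum_def by (subst sum.atMost_Suc_shift) (simp add: sum_negf)
  also have "(\<Sum>k\<le>n. (-1) ^ k * qbinom q (Suc n) (Suc k)) =
     (\<Sum>k\<le>n. (-1) ^ k * (q ^ (n - k) * qbinom q n k)) + (\<Sum>k\<le>n. (-1) ^ k * qbinom q n (Suc k))"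
    unfolding sum.distrib[symmetric]
    by (rule sum.cong) (simp_all add: qbinom_rec2 distrib_left del: qbinom.simps)
  also have "(\<Sum>k\<le>n. (-1) ^ k * qbinom q n (Suc k)) = 1 - (\<Sum>k\<le>Suc n. (-1) ^ k * qbinom q n k)"
    by (subst sum.atMost_Suc_shift) (simp add: sum_negf)
  also have "(\<Sum>k\<le>Suc n. (-1) ^ k * qbinom q n k) = (\<Sum>k\<le>n. (-1) ^ k * qbinom q n k)"
    by (simp add: qbinom_eq_0)
  finally show ?thesis
    by (simp add: algebra_simps sum_subtractf)
qed

text \<open>Gauss's recursion: the weight 1 - q^(n+1-k) from \<open>alt_qsum_Suc\<close> is absorbed
  by \<open>qbinom_Suc_left\<close> and leaves the constant 1 - q^(n+1).\<close>

lemma alt_qsum_rec: "alt_qsum q (Suc (Suc n)) = (1 - q ^ Suc n) * alt_qsum q n"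
proof -
  have "alt_qsum q (Suc (Suc n)) = (\<Sum>k\<le>Suc n. (-1) ^ k * ((1 - q ^ Suc n) * qbinom q n k))"
    unfolding alt_qsum_Suc by (rule sum.cong) (simp_all add: qbinom_Suc_left del: power_Suc)
  also have "\<dots> = (1 - q ^ Suc n) * (\<Sum>k\<le>Suc n. (-1) ^ k * qbinom q n k)"
    unfolding sum_distrib_left by (rule sum.cong) (simp_all only: mult_ac)
  also have "(\<Sum>k\<le>Suc n. (-1) ^ k * qbinom q n k) = alt_qsum q n"
    by (simp add: qbinom_eq_0 alt_qsum_def)
  finally show ?thesis .
qed

lemma alt_qsum_even: "alt_qsum q (2 * m) = (\<Prod>j<m. 1 - q ^ (2 * j + 1))"
proof (induction m)
  case 0
  show ?case by (simp add: alt_qsum_def)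
next
  case (Suc m)
  have "alt_qsum q (2 * Suc m) = (1 - q ^ Suc (2 * m)) * alt_qsum q (2 * m)"
    using alt_qsum_rec[of q "2 * m"] by simp
  with Suc show ?case by (simp add: mult.commute)
qed

text \<open>At a primitive root of unity of order n + 1 one has q^(n-k) = w^(k+1), so the ratio of
  neighbours is (1 - w^(k+1)) / (1 - q^(k+1)) = - w^(k+1). The exponents add up to triangular
  numbers, which turns the alternating sum into a quadratic Gauss sum.\<close>

lemma qbinom_root_of_unity:
  fixes q w :: "'a::field"
  assumes qw: "q * w = 1" and n: "q ^ Suc n = 1" and prim: "\<And>j. 0 < j \<Longrightarrow> j \<le> n \<Longrightarrow> q ^ j \<noteq> 1"
  shows "k \<le> n \<Longrightarrow> (-1) ^ k * qbinom q n k = w ^ (k * (k + 1) div 2)"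
proof (induction k)
  case (Suc k)
  have tri: "Suc k * (Suc k + 1) div 2 = k * (k + 1) div 2 + Suc k" by simp
  have "q ^ (n - k) * q ^ Suc k = 1" using Suc.prems n by (simp flip: power_add power_Suc)
  moreover have "w ^ Suc k * q ^ Suc k = 1" 
    using qw by (simp only: power_mult_distrib[symmetric] mult.commute[of w] power_one)
  moreover have "q ^ Suc k \<noteq> 0" using calculation by auto
  ultimately have qn: "q ^ (n - k) = w ^ Suc k" by (metis mult_right_cancel)
  have "(1 - q ^ Suc k) * qbinom q n (Suc k) = (1 - w ^ Suc k) * qbinom q n k"
    using qbinom_Suc_right[of k n q] Suc.prems qn by simp
  also have "1 - w ^ Suc k = - (w ^ Suc k) * (1 - q ^ Suc k)"
    using \<open>w ^ Suc k * q ^ Suc k = 1\<close> by (simp add: algebra_simps)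
  finally have "(1 - q ^ Suc k) * qbinom q n (Suc k) = (1 - q ^ Suc k) * (- (w ^ Suc k) * qbinom q n k)"
    by (simp only: mult_ac)
  then have "qbinom q n (Suc k) = - (w ^ Suc k) * qbinom q n k"
    by (rule mult_left_cancel[THEN iffD1, rotated]) (use prim[of "Suc k"] Suc.prems in simp)
  then have "(-1) ^ Suc k * qbinom q n (Suc k) = ((-1) ^ k * qbinom q n k) * w ^ Suc k" by simp
  also have "\<dots> = w ^ (k * (k + 1) div 2) * w ^ Suc k" using Suc by simp
  finally show ?case unfolding tri power_add .
qed simp

lemma sum_triangular_root_of_unity:
  fixes q w :: "'a::field"
  assumes qw: "q * w = 1" and n: "q ^ Suc (2 * m) = 1"
    and prim: "\<And>j. 0 < j \<Longrightarrow> j \<le> 2 * m \<Longrightarrow> q ^ j \<noteq> 1"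
  shows "(\<Sum>k\<le>2 * m. w ^ (k * (k + 1) div 2)) = (\<Prod>j<m. 1 - q ^ (2 * j + 1))"
proof -
  have "(\<Sum>k\<le>2 * m. w ^ (k * (k + 1) div 2)) = alt_qsum q (2 * m)"
    unfolding alt_qsum_def by (rule sum.cong) (simp_all add: qbinom_root_of_unity[OF qw n prim])
  then show ?thesis by (simp only: alt_qsum_even)
qed

section \<open>Gauss and Salie sums\<close>

locale prime_field3 =
  fixes p :: nat and ty :: "'f :: finite_field itself"
  assumes CARD_p: "CARD('f) = p" and CHAR_p: "CHAR('f) = p" and p_mod: "p mod 4 = 3"
begin

definition d :: nat where "d = (p - 1) div 2"

text \<open>That p is 3 modulo 4 enters as the oddness of \<open>d\<close>: it gives (-1)^d = -1, so
  -1 is a nonresidue.\<close>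

lemma p_eq: "p = 2 * d + 1" and d_odd: "odd d" and p_pos: "p > 0"
proof -
  show "p = 2 * d + 1" "p > 0" using p_mod unfolding d_def by presburger+
  show "odd d" using p_mod unfolding d_def by presburger
qed

lemma d_eq: "2 * ((d + 1) div 2) = d + 1" using d_odd by presburger

lemma two_nz: "(2 :: 'f) \<noteq> 0"
proof
  assume "(2 :: 'f) = 0"
  then have "of_nat 2 = (0 :: 'f)" by simp
  then have "p dvd 2" unfolding of_nat_eq_0_iff_char_dvd CHAR_p .
  then have "p \<le> 2" by (rule dvd_imp_le) simp
  with p_mod show False by (cases "p = 0 \<or> p = 1 \<or> p = 2") auto
qed

lemma bij_of_int: "bij_betw (of_int :: int \<Rightarrow> 'f) {0..<int p} UNIV"
proof -
  have inj: "inj_on (of_int :: int \<Rightarrow> 'f) {0..<int p}"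
    by (auto simp: inj_on_def of_int_eq_iff_cong_CHAR CHAR_p cong_def)
  have "card (of_int ` {0..<int p} :: 'f set) = card (UNIV :: 'f set)"
    using card_image[OF inj] CARD_p by simp
  then have "of_int ` {0..<int p} = (UNIV :: 'f set)"
    by (intro card_subset_eq) auto
  with inj show ?thesis by (simp add: bij_betw_def)
qed

lemma ex_of_int: "\<exists>k. x = (of_int k :: 'f)"
  using bij_betw_imp_surj_on[OF bij_of_int] by blast

lemma bij_of_nat: "bij_betw (of_nat :: nat \<Rightarrow> 'f) {..<p} UNIV"
proof -
  have "bij_betw int {..<p} {0..<int p}"
    by (rule bij_betw_byWitness[where f' = nat]) auto
  from bij_betw_trans[OF this bij_of_int] show ?thesis by (simp add: o_def)
qed

lemma CHAR_pos: "CHAR('f) > 0"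
  using CHAR_p p_pos by simp

lemma psi_int: "psi (of_int k :: 'f) = e (real_of_int k / real p)"
  by (simp only: psi_of_int[OF CHAR_pos] CHAR_p)

lemma psi_nat: "psi (of_nat k :: 'f) = e (real k / real p)"
  using psi_int[of "int k"] by simp

lemma psi_plus: "psi (x + y :: 'f) = psi x * psi y"
proof -
  obtain k l where "x = of_int k" "y = of_int l" using ex_of_int by metis
  then show ?thesis by (simp only: psi_add_of_int[OF CHAR_pos])
qed

lemma psi_eq_1: "psi x = 1 \<longleftrightarrow> x = (0 :: 'f)"
proof -
  obtain k where "x = of_int k" using ex_of_int by metis
  then show ?thesis by (simp only: psi_of_int_eq_1_iff[OF CHAR_pos])
qed

lemma psi_0: "psi (0 :: 'f) = 1" by (simp add: psi_eq_1)

lemma psi_uminus: "psi (- x :: 'f) = cnj (psi x)"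
proof -
  have "psi x * psi (-x) = 1" by (simp add: psi_0 flip: psi_plus)
  moreover have "psi x * cnj (psi x) = 1" by (simp add: complex_norm_square[symmetric])
  ultimately have "psi x * psi (-x) = psi x * cnj (psi x)" by simp
  moreover have "psi x \<noteq> 0" using norm_psi[of x] by (metis norm_zero zero_neq_one)
  ultimately show ?thesis by simp
qed

lemma sum_psi: "c \<noteq> 0 \<Longrightarrow> (\<Sum>x\<in>UNIV. psi (c * x :: 'f)) = 0"
proof -
  assume c: "c \<noteq> 0"
  let ?S = "\<Sum>x\<in>UNIV. psi (c * x)"
  have "?S = (\<Sum>x\<in>UNIV. psi (c * (x + 1)))"
    by (rule sum.reindex_bij_witness[of _ "\<lambda>x. x + 1" "\<lambda>x. x - 1"]) auto
  also have "\<dots> = ?S * psi c" by (simp add: distrib_left psi_plus sum_distrib_right)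
  finally have "?S * (psi c - 1) = 0" by (simp add: algebra_simps)
  with c show ?thesis by (simp add: psi_eq_1)
qed

lemma sum_psi_units: "c \<noteq> 0 \<Longrightarrow> (\<Sum>x\<in>UNIV - {0}. psi (c * x :: 'f)) = -1"
  using sum_psi[of c] sum.remove[of UNIV 0 "\<lambda>x. psi (c * x)"] by (simp add: psi_0 add_eq_0_iff)

section \<open>Quadratic residues and the half sums over them\<close>

definition Q :: "'f set" where "Q = {u. u ^ d = 1}"

lemma pow_2d: "x \<noteq> 0 \<Longrightarrow> x ^ (2 * d) = (1 :: 'f)"
  using finite_field_power_card_eq_same[of x] unfolding CARD_p by (subst (asm) p_eq) simp

lemma Q_nonzero: "x \<in> Q \<Longrightarrow> x \<noteq> 0" and Q_mult: "x \<in> Q \<Longrightarrow> y \<in> Q \<Longrightarrow> x * y \<in> Q"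
  and Q_divide: "x \<in> Q \<Longrightarrow> y \<in> Q \<Longrightarrow> x / y \<in> Q" and Q_1: "1 \<in> Q"
  and Q_square: "x \<noteq> 0 \<Longrightarrow> x * x \<in> Q"
  using d_odd pow_2d[of x]
  by (auto simp: Q_def power_mult_distrib power_divide power_0_left mult_2 power_add split: if_splits)

lemma one_neq_minus_one: "1 \<noteq> (-1 :: 'f)"
  using two_nz by (metis add.right_inverse one_add_one)

lemma Q_uminus: "x \<noteq> 0 \<Longrightarrow> - x \<in> Q \<longleftrightarrow> x \<notin> Q"
proof -
  assume "x \<noteq> 0"
  then have "x ^ d * x ^ d = 1" using pow_2d by (simp add: mult_2 power_add)
  then have "x ^ d = 1 \<or> x ^ d = -1" by (simp add: square_eq_1_iff)
  then show ?thesis using d_odd one_neq_minus_one by (auto simp: Q_def)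
qed

text \<open>As d + 1 is even and x^(d+1) = x, the power x^((d+1)/2) is an explicit square
  root.\<close>

lemma Q_sqrt: "x \<in> Q \<Longrightarrow> \<exists>y. y * y = x"
proof -
  assume "x \<in> Q"
  then have "x ^ (d + 1) = x" by (simp add: Q_def)
  then have "x ^ ((d + 1) div 2) * x ^ ((d + 1) div 2) = x"
    unfolding power_add[symmetric] mult_2[symmetric] d_eq .
  then show ?thesis by blast
qed

definition KQ :: "'f \<Rightarrow> 'f \<Rightarrow> complex" where
  "KQ a b = (\<Sum>u\<in>Q. psi (a * u + b / u))"

definition chi :: "'f \<Rightarrow> complex" where
  "chi x = (if x = 0 then 0 else if x \<in> Q then 1 else -1)"

lemma cnj_KQ: "cnj (KQ a b) = KQ (- a) (- b)"
  unfolding KQ_def cnj_sum psi_uminus[symmetric] by simp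

lemma sum_units_Q: "(\<Sum>u\<in>UNIV - {0}. f u :: complex) = (\<Sum>u\<in>Q. f u) + (\<Sum>u\<in>Q. f (- u))"
proof -
  have "(\<Sum>u\<in>UNIV - {0}. f u) = (\<Sum>u\<in>Q. f u) + (\<Sum>u\<in>UNIV - {0} - Q. f u)"
    using Q_nonzero by (subst sum.subset_diff[of Q]) auto
  also have "(\<Sum>u\<in>UNIV - {0} - Q. f u) = (\<Sum>u\<in>Q. f (- u))"
    by (rule sum.reindex_bij_witness[of _ uminus uminus])
       (use Q_uminus Q_nonzero Q_uminus[of "- _"] in auto)
  finally show ?thesis .
qed

lemma KQ_plus_cnj: "KQ a b + cnj (KQ a b) = (\<Sum>u\<in>UNIV - {0}. psi (a * u + b / u))"
  unfolding cnj_KQ sum_units_Q by (simp add: KQ_def)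

lemma KQ_minus_cnj: "KQ a b - cnj (KQ a b) = (\<Sum>u\<in>UNIV - {0}. chi u * psi (a * u + b / u))"
proof -
  have "(\<Sum>u\<in>Q. chi u * psi (a * u + b / u)) = KQ a b"
    unfolding KQ_def by (rule sum.cong) (auto simp: chi_def Q_nonzero)
  moreover have "(\<Sum>u\<in>Q. chi (- u) * psi (a * (- u) + b / (- u))) = - cnj (KQ a b)"
    unfolding cnj_KQ unfolding KQ_def sum_negf[symmetric]
    by (rule sum.cong) (use Q_uminus Q_nonzero in \<open>auto simp: chi_def\<close>)
  ultimately show ?thesis unfolding sum_units_Q by simp
qed

lemma KQ_swap: "KQ 0 b = KQ b 0"
  unfolding KQ_def
  by (rule sum.reindex_bij_witness[of _ inverse inverse]) 
     (use Q_divide[OF Q_1] in \<open>auto simp: inverse_eq_divide\<close>)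

lemma KQ_residue: "b \<in> Q \<Longrightarrow> KQ b 0 = KQ 1 0"
  unfolding KQ_def
  by (rule sum.reindex_bij_witness[of _ "\<lambda>u. u / b" "\<lambda>u. b * u"])
     (auto simp: Q_nonzero Q_mult Q_divide)

lemma KQ_nonresidue: "- b \<in> Q \<Longrightarrow> KQ b 0 = cnj (KQ 1 0)"
  using KQ_residue[of "- b"] cnj_KQ[of "- b" 0] by simp

lemma Re_KQ: "c \<noteq> 0 \<Longrightarrow> Re (KQ c 0) = - 1 / 2"
proof -
  assume c: "c \<noteq> 0"
  have "KQ c 0 + cnj (KQ c 0) = -1" unfolding KQ_plus_cnj using sum_psi_units[OF c] by simp
  then have "2 * Re (KQ c 0) = -1" by (simp add: complex_add_cnj complex_eq_iff)
  then show ?thesis by simp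
qed

section \<open>The quadratic Gauss sum: modulus and sign\<close>

definition G :: complex where "G = (\<Sum>v\<in>UNIV. psi (v * v :: 'f))"

lemma G_eq_KQ: "G = 1 + 2 * KQ 1 0"
proof -
  have fibre: "card {v \<in> UNIV - {0}. v * v = u} = 2" if u: "u \<in> Q" for u
  proof -
    obtain y where y: "y * y = u" using Q_sqrt[OF u] by blast
    with Q_nonzero[OF u] have "y \<noteq> 0" by auto
    have "y \<noteq> - y" using two_nz \<open>y \<noteq> 0\<close> by (metis add.right_inverse mult_2 mult_eq_0_iff)
    moreover have "{v \<in> UNIV - {0}. v * v = u} = {y, - y}"
      using y \<open>y \<noteq> 0\<close> by (auto simp: square_eq_iff)
    ultimately show ?thesis by simp
  qed
  have "G = 1 + (\<Sum>v\<in>UNIV - {0}. psi (v * v :: 'f))"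
    unfolding G_def by (subst sum.remove[of _ 0]) (auto simp: psi_0)
  also have "(\<Sum>v\<in>UNIV - {0}. psi (v * v :: 'f)) = (\<Sum>u\<in>Q. of_nat (card {v \<in> UNIV - {0}. v * v = u}) * psi u)"
    by (rule sum_fun_comp) (use Q_square in auto)
  also have "\<dots> = (\<Sum>u\<in>Q. 2 * psi u)"
    by (rule sum.cong) (simp_all only: fibre of_nat_numeral)
  finally show ?thesis by (simp add: KQ_def sum_distrib_left)
qed

lemma Re_G: "Re G = 0"
  using Re_KQ[of 1] by (simp add: G_eq_KQ)

text \<open>With x = h + y the phase x^2 - y^2 becomes h^2 + 2 h y, linear in y; summing over y
  leaves only h = 0.\<close>

lemma norm_G: "G * cnj G = of_nat p"
proof -
  have "G * cnj G = (\<Sum>y\<in>UNIV. \<Sum>x\<in>UNIV. psi (x * x - y * y :: 'f))"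
    unfolding G_def cnj_sum sum_product psi_uminus[symmetric] psi_plus[symmetric]
    by (subst sum.swap) simp
  also have "\<dots> = (\<Sum>y\<in>UNIV. \<Sum>h\<in>UNIV. psi ((h + y) * (h + y) - y * y :: 'f))"
  proof (rule sum.cong)
    fix y :: 'f
    show "(\<Sum>x\<in>UNIV. psi (x * x - y * y)) = (\<Sum>h\<in>UNIV. psi ((h + y) * (h + y) - y * y))"
      by (rule sum.reindex_bij_witness[of _ "\<lambda>h. h + y" "\<lambda>x. x - y"]) auto
  qed simp
  also have "\<dots> = (\<Sum>h\<in>UNIV. \<Sum>y\<in>UNIV. psi (h * h) * psi ((2 * h) * y :: 'f))"
    by (subst sum.swap) (simp add: psi_plus[symmetric] algebra_simps)
  also have "\<dots> = (\<Sum>h\<in>UNIV. psi (h * h) * (\<Sum>y\<in>UNIV. psi ((2 * h) * y :: 'f)))"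
    by (simp add: sum_distrib_left)
  also have "\<dots> = (\<Sum>h\<in>(UNIV :: 'f set). if h = 0 then of_nat p else 0)"
    by (rule sum.cong) (auto simp: sum_psi two_nz psi_0 CARD_p)
  finally show ?thesis by simp
qed

end

text \<open>Splits each factor of the product formula into a unimodular phase and i times a real
  number, whose sign can be read off.\<close>

lemma one_minus_e: "1 - e (- 2 * x) = e (- x) * (2 * \<i> * of_real (sin (2 * pi * x)))"
proof -
  have e_cis: "e y = cis (2 * pi * y)" for y by (simp add: e_def cis_conv_exp mult_ac)
  have "1 - e (- 2 * x) = e (- x) * (e x - e (- x))"
    unfolding right_diff_distrib e_add[symmetric] by (simp add: e_def)
  also have "e x - e (- x) = 2 * \<i> * of_real (sin (2 * pi * x))"
    by (simp add: e_cis complex_eq_iff)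
  finally show ?thesis .
qed

lemma prod_e: "(\<Prod>j\<in>A. e (f j)) = e (\<Sum>j\<in>A. f j)"
  by (induction A rule: infinite_finite_induct) (simp_all add: e_add, simp_all add: e_def)

context prime_field3
begin

text \<open>Completing the square turns the triangular sum into \<open>G\<close> times a phase, and
  the product formula evaluates it. The phases of the factors cancel against that of the
  square.\<close>

lemma G_prod: "G = (\<Prod>j<d. 2 * \<i> * of_real (sin (2 * pi * (real (2 * j + 1) / real p))))"
proof -
  \<comment> \<open>The 2 in the exponent of \<open>w\<close> cancels the halving in k (k + 1) / 2,
    so that \<open>w\<close> to the triangular number is e(k (k + 1) / p).\<close>
  define q w where "q = e (- 2 / real p)" and "w = e (2 / real p)"
  have e_pow: "e x ^ n = e (real n * x)" for x n
    by (induction n) (simp_all add: e_add[symmetric] distrib_right add.commute, simp_all add: e_def)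
  have q_pow: "q ^ j = e (- 2 * (real j / real p))" for j
    unfolding q_def e_pow by (simp add: mult_ac)
  have w_pow: "w ^ j = e (real (2 * j) / real p)" for j
    unfolding w_def e_pow by (simp add: mult_ac)
  have qw: "q * w = 1"
    unfolding q_def w_def e_add[symmetric] by (simp add: e_def)
  have q_eq_1: "q ^ j = 1 \<longleftrightarrow> p dvd j" for j
  proof -
    have "q ^ j = e (real_of_int (- 2 * int j) / real p)"
      unfolding q_pow by simp
    also have "\<dots> = 1 \<longleftrightarrow> int p dvd - 2 * int j"
      by (rule e_div_eq_1_iff[OF p_pos])
    also have "\<dots> \<longleftrightarrow> int p dvd 2 * int j" by simp
    also have "\<dots> \<longleftrightarrow> p dvd 2 * j" by (metis int_dvd_int_iff of_nat_mult of_nat_numeral)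
    also have "\<dots> \<longleftrightarrow> p dvd j"
    proof (rule coprime_dvd_mult_right_iff)
      have "odd p" using p_eq by presburger
      then show "coprime p 2" by simp
    qed
    finally show ?thesis .
  qed
  have tri: "(\<Sum>k\<le>2 * d. w ^ (k * (k + 1) div 2)) = (\<Prod>j<d. 1 - q ^ (2 * j + 1))"
  proof (rule sum_triangular_root_of_unity[OF qw])
    show "q ^ Suc (2 * d) = 1" unfolding q_eq_1 using p_eq by simp
    show "q ^ j \<noteq> 1" if "0 < j" "j \<le> 2 * d" for j
      unfolding q_eq_1 using that p_eq by (auto dest: dvd_imp_le)
  qed
  \<comment> \<open>This is 1/2 in the field, since 2 (d + 1) = p + 1. It completes the square: v (v
    + 1) = (v + c)^2 - c^2.\<close>
  define c :: 'f where "c = of_nat (d + 1)"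
  have two_c: "2 * c = 1"
  proof -
    have "2 * c = of_nat (2 * (d + 1))" by (simp add: c_def)
    also have "2 * (d + 1) = p + 1" using p_eq by simp
    also have "of_nat (p + 1) = (1 :: 'f)" using of_nat_CHAR[where 'a = 'f] CHAR_p by simp
    finally show ?thesis .
  qed
  have "(\<Sum>k\<le>2 * d. w ^ (k * (k + 1) div 2)) = (\<Sum>k<p. psi (of_nat (k * (k + 1)) :: 'f))"
    unfolding psi_nat w_pow using p_eq by (intro sum.cong) auto
  also have "\<dots> = (\<Sum>k<p. (\<lambda>v. psi (v * (v + 1) :: 'f)) (of_nat k))"
    by (simp only: of_nat_mult of_nat_add of_nat_1)
  also have "\<dots> = (\<Sum>v\<in>UNIV. psi (v * (v + 1) :: 'f))"
    by (rule sum.reindex_bij_betw[OF bij_of_nat])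
  also have "\<dots> = (\<Sum>v\<in>UNIV. psi ((v - c) * (v - c + 1) :: 'f))"
    by (rule sum.reindex_bij_witness[of _ "\<lambda>v. v - c" "\<lambda>v. v + c"]) auto
  also have "\<dots> = (\<Sum>v\<in>UNIV. psi (v * v :: 'f) * psi (- (c * c)))"
  proof (rule sum.cong)
    fix v :: 'f
    have "(v - c) * (v - c + 1) = v * v + (- (c * c)) + (1 - 2 * c) * (v - c)"
      by (simp add: algebra_simps)
    then show "psi ((v - c) * (v - c + 1)) = psi (v * v) * psi (- (c * c))"
      by (simp add: two_c flip: psi_plus)
  qed simp
  also have "\<dots> = G * psi (- (c * c))" by (simp add: G_def sum_distrib_right)
  finally have "G * psi (- (c * c)) = (\<Prod>j<d. 1 - q ^ (2 * j + 1))"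
    using tri by simp
  moreover have "psi (- (c * c)) * psi (c * c) = 1"
    by (simp add: psi_0 flip: psi_plus)
  ultimately have "G = (\<Prod>j<d. 1 - q ^ (2 * j + 1)) * psi (c * c)"
    by (metis mult.assoc mult.right_neutral)
  also have "(\<Prod>j<d. 1 - q ^ (2 * j + 1)) =
      (\<Prod>j<d. e (- (real (2 * j + 1) / real p))) *
      (\<Prod>j<d. 2 * \<i> * of_real (sin (2 * pi * (real (2 * j + 1) / real p))))"
    unfolding q_pow one_minus_e prod.distrib ..
  also have "(\<Prod>j<d. e (- (real (2 * j + 1) / real p))) = e (- (real (d * d) / real p))"
  proof -
    have "(\<Sum>j<n. real (2 * j + 1)) = real (n * n)" for n by (induction n) simp_all
    then show ?thesis unfolding prod_e sum_negf sum_divide_distrib[symmetric] by simp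
  qed
  also have "psi (c * c) = e (real ((d + 1) * (d + 1)) / real p)"
    unfolding c_def of_nat_mult[symmetric] by (rule psi_nat)
  also have "e (- (real (d * d) / real p)) *
      (\<Prod>j<d. 2 * \<i> * of_real (sin (2 * pi * (real (2 * j + 1) / real p)))) *
      e (real ((d + 1) * (d + 1)) / real p) =
      e (- (real (d * d) / real p) + real ((d + 1) * (d + 1)) / real p) *
      (\<Prod>j<d. 2 * \<i> * of_real (sin (2 * pi * (real (2 * j + 1) / real p))))"
    unfolding e_add by (simp only: mult_ac)
  \<comment> \<open>The numerator is (d + 1)^2 - d^2 = 2 d + 1 = p; here d^2 is the sum of the first
    d odd numbers.\<close>
  also have "- (real (d * d) / real p) + real ((d + 1) * (d + 1)) / real p = 1"
    using p_eq by (simp add: field_simps)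
  also have "e 1 = 1" by (simp add: e_eq_1_iff)
  finally show ?thesis by simp
qed

text \<open>Write d = 2 t + 1. The first t + 1 sines have angles in (0, pi) and are positive, the
  other t have angles in (pi, 2 pi) and are negative. The remaining unit is i^(t+1) (-i)^t =
  i.\<close>

lemma Im_G_pos: "Im G > 0"
proof -
  define s where "s = (\<lambda>j. sin (2 * pi * (real (2 * j + 1) / real p)))"
  define t where "t = d div 2"
  have d: "d = t + 1 + t" using d_odd unfolding t_def by presburger
  have pos: "s j > 0" if "j < t + 1" for j
    unfolding s_def
  proof (rule sin_gt_zero)
    show "0 < 2 * pi * (real (2 * j + 1) / real p)" using p_pos by simp
    have "2 * (2 * j + 1) < p" using that p_eq d by simp
    then have "2 * real (2 * j + 1) < real p" by linarith
    then have "2 * real (2 * j + 1) / real p < 1" using p_pos by simp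
    then have "pi * (2 * real (2 * j + 1) / real p) < pi * 1" by (intro mult_strict_left_mono) auto
    then show "2 * pi * (real (2 * j + 1) / real p) < pi" by (simp only: mult_ac times_divide_eq_right mult_1_right)
  qed
  have neg: "s (t + 1 + j) < 0" if "j < t" for j
    unfolding s_def
  proof (rule sin_lt_zero)
    have "p < 2 * (2 * (t + 1 + j) + 1)" using p_eq d by simp
    then have "real p < 2 * real (2 * (t + 1 + j) + 1)" by linarith
    then have "1 < 2 * real (2 * (t + 1 + j) + 1) / real p" using p_pos by simp
    then have "pi * 1 < pi * (2 * real (2 * (t + 1 + j) + 1) / real p)" by (intro mult_strict_left_mono) auto
    then show "pi < 2 * pi * (real (2 * (t + 1 + j) + 1) / real p)"
      by (simp only: mult_ac times_divide_eq_right mult_1_right)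
    have "2 * (t + 1 + j) + 1 < p" using that p_eq d by simp
    then have "real (2 * (t + 1 + j) + 1) < real p" by linarith
    then have "real (2 * (t + 1 + j) + 1) / real p < 1" using p_pos by simp
    then have "2 * pi * (real (2 * (t + 1 + j) + 1) / real p) < 2 * pi * 1"
      by (intro mult_strict_left_mono) auto
    then show "2 * pi * (real (2 * (t + 1 + j) + 1) / real p) < 2 * pi" by simp
  qed
  have prod_split: "(\<Prod>j<n + k. f j) = (\<Prod>j<n. f j) * (\<Prod>j<k. f (n + j))"
    for f :: "nat \<Rightarrow> complex" and n k
    by (induction k) (simp_all add: mult.assoc)
  have "G = (\<Prod>j<t + 1 + t. 2 * \<i> * of_real (s j))"
    using G_prod by (simp add: d s_def)
  also have "\<dots> = (\<Prod>j<t + 1. 2 * \<i> * of_real (s j)) * (\<Prod>j<t. 2 * \<i> * of_real (s (t + 1 + j)))"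
    by (rule prod_split)
  also have "(\<Prod>j<t + 1. 2 * \<i> * of_real (s j)) = \<i> ^ (t + 1) * of_real (\<Prod>j<t + 1. 2 * s j)"
    by (simp add: prod.distrib power_mult_distrib mult_ac)
  also have "(\<Prod>j<t. 2 * \<i> * of_real (s (t + 1 + j))) = (- \<i>) ^ t * of_real (\<Prod>j<t. 2 * (- s (t + 1 + j)))"
  proof -
    have "(\<Prod>j<t. 2 * \<i> * of_real (s (t + 1 + j))) = (\<Prod>j<t. (- \<i>) * of_real (2 * (- s (t + 1 + j))))"
      by (rule prod.cong) simp_all
    also have "\<dots> = (\<Prod>j<t. - \<i>) * (\<Prod>j<t. of_real (2 * (- s (t + 1 + j))))"
      by (rule prod.distrib)
    finally show ?thesis by (simp only: prod_constant card_lessThan of_real_prod)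
  qed
  finally have "G = (\<i> * (\<i> * (- \<i>)) ^ t) * of_real ((\<Prod>j<t + 1. 2 * s j) * (\<Prod>j<t. 2 * (- s (t + 1 + j))))"
    by (simp only: power_mult_distrib power_add power_one_right of_real_mult mult_ac)
  then have "Im G = (\<Prod>j<t + 1. 2 * s j) * (\<Prod>j<t. 2 * (- s (t + 1 + j)))"
    by (simp del: of_real_mult of_real_prod prod.lessThan_Suc)
  also have "\<dots> > 0"
    using pos neg by (intro mult_pos_pos prod_pos) auto
  finally show ?thesis .
qed

lemma G_eq: "G = \<i> * of_real (sqrt (real p))"
proof -
  have "Im G ^ 2 = real p"
    using norm_G Re_G by (simp add: complex_mult_cnj complex_eq_iff)
  then have "Im G = sqrt (real p)" using Im_G_pos by (metis less_imp_le real_sqrt_unique)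
  with Re_G show ?thesis by (simp add: complex_eq_iff)
qed

lemma KQ_1_0: "KQ 1 0 = (\<i> * of_real (sqrt (real p)) - 1) / 2"
  using G_eq_KQ unfolding G_eq by (simp add: field_simps)

text \<open>For a nonresidue b the sum is the complex conjugate of the one for a residue, which
  flips the sign of the imaginary part.\<close>

lemma KQ_left_0:
  assumes "b \<noteq> 0"
  shows "KQ 0 b = 1 / 2 * (chi b * \<i> * of_real (sqrt (real p)) - 1)"
proof (cases "b \<in> Q")
  case True
  then show ?thesis using KQ_residue[OF True] assms by (simp add: KQ_swap KQ_1_0 chi_def)
next
  case False
  then have "- b \<in> Q" using Q_uminus[OF assms] by simp
  then show ?thesis using KQ_nonresidue[of b] assms False by (simp add: KQ_swap KQ_1_0 chi_def)
qed

section \<open>The quadratic character and the Salie sum\<close>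

lemma chi_mult: "chi (x * y) = chi x * chi y"
proof (cases "x = 0 \<or> y = 0")
  case False
  then have nz: "x \<noteq> 0" "y \<noteq> 0" "x * y \<noteq> 0" by auto
  consider "x \<in> Q" "y \<in> Q" | "x \<in> Q" "- y \<in> Q" | "- x \<in> Q" "y \<in> Q" | "- x \<in> Q" "- y \<in> Q"
    using Q_uminus nz by blast
  then show ?thesis
  proof cases
    case 1
    then show ?thesis using Q_mult[OF 1] nz by (simp add: chi_def)
  next
    case 2
    then show ?thesis using Q_mult[OF 2] nz Q_uminus by (simp add: chi_def)
  next
    case 3
    then show ?thesis using Q_mult[OF 3] nz Q_uminus by (simp add: chi_def)
  next
    case 4
    then show ?thesis using Q_mult[OF 4] nz Q_uminus by (simp add: chi_def)
  qed
qed (auto simp: chi_def)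

lemma chi_0: "chi 0 = 0"
  by (simp add: chi_def)

lemma chi_square: "x \<noteq> 0 \<Longrightarrow> chi (x * x) = 1"
  using Q_square by (simp add: chi_def)

lemma chi_values: "x \<noteq> 0 \<Longrightarrow> chi x = 1 \<or> chi x = -1"
  by (simp add: chi_def)

lemma chi_4: "chi (2 * 2 * x) = chi x"
  using chi_mult[of "2 * 2" x] chi_square[OF two_nz] by simp

text \<open>A solution u satisfies u (t + 2 s) = (u + s)^2 and u (t - 2 s) = (u - s)^2, so chi u
  agrees with each of chi (t + 2 s) and chi (t - 2 s) that is nonzero. The discriminant is (t + 2 s)
  (t - 2 s). If the two values agree there are two solutions; if they are opposite there are none;
  if one is 0 there is the double solution t/2. This reduces the Salie sum to two shifted Gauss
  sums.\<close>

lemma sum_chi_fibre: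
  assumes s: "s \<noteq> 0"
  shows "(\<Sum>u | u \<noteq> 0 \<and> u + s * s / u = t. chi u) = chi (t + 2 * s) + chi (t - 2 * s)"
proof -
  let ?A = "{u. u \<noteq> 0 \<and> u + s * s / u = t}"
  have A: "u \<in> ?A \<longleftrightarrow> u * u + s * s = t * u" for u
  proof (cases "u = 0")
    case False
    then have "u + s * s / u = (u * u + s * s) / u" by (simp add: field_simps)
    with False show ?thesis by (simp add: divide_eq_eq)
  qed (use s in simp)
  have plus: "u * (t + 2 * s) = (u + s) * (u + s)" and minus: "u * (t - 2 * s) = (u - s) * (u - s)"
    if "u \<in> ?A" for u
    using that unfolding A by (simp_all add: algebra_simps)
  show ?thesis
  proof (cases "t + 2 * s = 0 \<or> t - 2 * s = 0")
    case True
    then obtain r where r: "r = s \<or> r = - s" "t = 2 * r"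
      by (metis add_eq_0_iff2 eq_iff_diff_eq_0 mult_minus_right)
    have "u \<in> ?A \<longleftrightarrow> u = r" for u
    proof -
      have "u \<in> ?A \<longleftrightarrow> (u - r) * (u - r) = 0"
        unfolding A using r by (auto simp: algebra_simps)
      then show ?thesis by simp
    qed
    then have "?A = {r}" by blast
    moreover have "(t + 2 * s = 2 * 2 * r \<and> t - 2 * s = 0) \<or> (t + 2 * s = 0 \<and> t - 2 * s = 2 * 2 * r)"
      using r by auto
    then have "chi (t + 2 * s) + chi (t - 2 * s) = chi r"
      by (elim disjE conjE) (simp_all only: chi_4 chi_0 add_0 add_0_right)
    ultimately show ?thesis by simp
  next
    case False
    then have nz: "t + 2 * s \<noteq> 0" "t - 2 * s \<noteq> 0" by auto
    have chi_u: "chi u = chi (t + 2 * s)" "chi u = chi (t - 2 * s)" if u: "u \<in> ?A" for u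
    proof -
      have "u \<noteq> 0" using u by simp
      have "chi u * chi (t + 2 * s) = 1"
        unfolding chi_mult[symmetric] plus[OF u] using plus[OF u] nz \<open>u \<noteq> 0\<close> by (intro chi_square) auto
      then show "chi u = chi (t + 2 * s)" using chi_values[OF nz(1)] chi_values[OF \<open>u \<noteq> 0\<close>] by auto
      have "chi u * chi (t - 2 * s) = 1"
        unfolding chi_mult[symmetric] minus[OF u] using minus[OF u] nz \<open>u \<noteq> 0\<close> by (intro chi_square) auto
      then show "chi u = chi (t - 2 * s)" using chi_values[OF nz(2)] chi_values[OF \<open>u \<noteq> 0\<close>] by auto
    qed
    show ?thesis
    proof (cases "chi (t + 2 * s) = chi (t - 2 * s)")
      case False
      have "u \<notin> ?A" for u using chi_u[of u] False by metis
      then have "?A = {}" by blast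
      moreover have "chi (t + 2 * s) + chi (t - 2 * s) = 0"
        using False chi_values[OF nz(1)] chi_values[OF nz(2)] by auto
      ultimately show ?thesis by (simp only: sum.empty)
    next
      case True
      have "chi ((t + 2 * s) * (t - 2 * s)) = 1"
        using True chi_values[OF nz(2)] unfolding chi_mult by auto
      then have "(t + 2 * s) * (t - 2 * s) \<in> Q" by (auto simp: chi_def split: if_splits)
      then obtain r where r: "r * r = (t + 2 * s) * (t - 2 * s)" using Q_sqrt by blast
      with nz have "r \<noteq> 0" by auto
      define u1 u2 where "u1 = (t + r) / 2" and "u2 = (t - r) / 2"
      have half: "2 * (x / 2) = x" for x :: 'f using two_nz by simp
      have two: "2 * (u1 + u2) = 2 * t" "2 * (u1 - u2) = 2 * r"
        unfolding u1_def u2_def distrib_left right_diff_distrib half by simp_all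
      have sum12: "u1 + u2 = t" and diff12: "u1 - u2 = r"
        by (rule mult_left_cancel[OF two_nz, THEN iffD1], rule two)+
      have "2 * 2 * (u1 * u2) = (2 * u1) * (2 * u2)" by (simp only: mult_ac)
      also have "\<dots> = t * t - r * r"
        unfolding u1_def u2_def half by (simp add: algebra_simps)
      also have "\<dots> = 2 * 2 * (s * s)" unfolding r by (simp add: algebra_simps)
      finally have prod12: "u1 * u2 = s * s" using two_nz by (metis mult_left_cancel mult_eq_0_iff)
      have "u \<in> ?A \<longleftrightarrow> (u - u1) * (u - u2) = 0" for u
      proof -
        have "u \<in> ?A \<longleftrightarrow> u * u + u1 * u2 = (u1 + u2) * u"
          unfolding prod12 sum12 by (rule A)
        also have "\<dots> \<longleftrightarrow> (u - u1) * (u - u2) = 0" by (auto simp: algebra_simps)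
        finally show ?thesis .
      qed
      then have A12: "?A = {u1, u2}" by (simp add: set_eq_iff)
      have "u1 \<noteq> u2" using diff12 \<open>r \<noteq> 0\<close> by auto
      then have "(\<Sum>u\<in>?A. chi u) = chi u1 + chi u2" unfolding A12 by simp
      moreover have "u1 \<in> ?A" "u2 \<in> ?A" unfolding A12 by simp_all
      ultimately show ?thesis using chi_u(1)[of u1] chi_u(2)[of u2] by simp
    qed
  qed
qed

lemma norm_KQ_minus_cnj_0:
  assumes "a \<noteq> 0"
  shows "norm (KQ a 0 - cnj (KQ a 0)) = sqrt (real p)"
proof -
  have "KQ a 0 - cnj (KQ a 0) = chi a * \<i> * of_real (sqrt (real p))"
    unfolding KQ_swap[symmetric] KQ_left_0[OF assms] using chi_values[OF assms]
    by (auto simp: complex_eq_iff)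
  moreover have "norm (chi a) = 1" using chi_values[OF assms] by auto
  ultimately show ?thesis by (simp add: norm_mult)
qed

lemma Im_KQ_bound:
  assumes a: "a \<noteq> 0" and b: "b \<noteq> 0"
  shows "\<bar>Im (KQ a b)\<bar> \<le> sqrt (real p)"
proof (cases "b / a \<in> Q")
  case True
  then obtain s where s: "s * s = b / a" using Q_sqrt by blast
  with a b have s0: "s \<noteq> 0" by auto
  have bs: "b = a * (s * s)" using s a by simp
  define g where "g = (\<Sum>t\<in>UNIV. chi t * psi (a * t))"
  have g: "g = KQ a 0 - cnj (KQ a 0)"
    unfolding g_def KQ_minus_cnj by (subst sum.remove[of _ 0]) (auto simp: chi_def)
  have shift: "(\<Sum>t\<in>UNIV. chi (t + c) * psi (a * t)) = psi (- (a * c)) * g" for c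
  proof -
    have "(\<Sum>t\<in>UNIV. chi (t + c) * psi (a * t)) = (\<Sum>t\<in>UNIV. chi t * psi (a * (t - c)))"
      by (rule sum.reindex_bij_witness[of _ "\<lambda>t. t - c" "\<lambda>t. t + c"]) auto
    also have "\<dots> = (\<Sum>t\<in>UNIV. psi (- (a * c)) * (chi t * psi (a * t)))"
      by (rule sum.cong) (simp_all add: right_diff_distrib psi_plus[of "a * _" "- _", simplified])
    finally show ?thesis by (simp add: g_def sum_distrib_left)
  qed
  have "KQ a b - cnj (KQ a b) = (\<Sum>u\<in>UNIV - {0}. chi u * psi (a * (u + s * s / u)))"
    unfolding KQ_minus_cnj bs by (simp add: distrib_left)
  also have "\<dots> = (\<Sum>t\<in>UNIV. \<Sum>u\<in>{u \<in> UNIV - {0}. u + s * s / u = t}. chi u * psi (a * (u + s * s / u)))"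
    by (rule sum.group[symmetric]) auto
  also have "\<dots> = (\<Sum>t\<in>UNIV. (\<Sum>u | u \<noteq> 0 \<and> u + s * s / u = t. chi u) * psi (a * t))"
    unfolding sum_distrib_right by (intro sum.cong) auto
  also have "\<dots> = (\<Sum>t\<in>UNIV. chi (t + 2 * s) * psi (a * t)) + (\<Sum>t\<in>UNIV. chi (t + (- (2 * s))) * psi (a * t))"
    unfolding sum_chi_fibre[OF s0] by (simp add: distrib_right sum.distrib)
  also have "\<dots> = psi (- (a * (2 * s))) * g + psi (- (a * (- (2 * s)))) * g"
    unfolding shift ..
  finally have eq: "KQ a b - cnj (KQ a b) = psi (- (a * (2 * s))) * g + psi (- (a * (- (2 * s)))) * g" .
  have "norm (KQ a b - cnj (KQ a b)) \<le> norm (psi (- (a * (2 * s))) * g) + norm (psi (- (a * (- (2 * s)))) * g)"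
    unfolding eq by (rule norm_triangle_ineq)
  also have "\<dots> = norm g + norm g" by (simp only: norm_mult norm_psi mult_1_left)
  also have "norm g = sqrt (real p)" unfolding g by (rule norm_KQ_minus_cnj_0[OF a])
  finally have "norm (KQ a b - cnj (KQ a b)) \<le> 2 * sqrt (real p)" by simp
  moreover have "norm (KQ a b - cnj (KQ a b)) = 2 * \<bar>Im (KQ a b)\<bar>"
    by (simp add: complex_diff_cnj norm_mult)
  ultimately show ?thesis by simp
next
  case False
  \<comment> \<open>As b/a is a nonresidue, r is a residue, and u -> r/u permutes \<open>Q\<close>
    while it carries the phase of (a, b) to that of (-a, -b). So the sum equals its own
    conjugate.\<close>
  define r where "r = - (b / a)"
  have r: "r \<in> Q" using False Q_uminus[of "b / a"] a b by (simp add: r_def)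
  have b_eq: "b = - (a * r)" using a by (simp add: r_def)
  have "KQ a b = KQ (- a) (- b)"
    unfolding KQ_def
  proof (rule sum.reindex_bij_witness[of _ "\<lambda>u. r / u" "\<lambda>u. r / u"])
    fix u assume u: "u \<in> Q"
    then show "r / u \<in> Q" using r by (rule Q_divide[rotated])
    then show "r / u \<in> Q" .
    show "r / (r / u) = u" using Q_nonzero[OF r] by simp
    then show "r / (r / u) = u" .
    show "psi (- a * (r / u) + - b / (r / u)) = psi (a * u + b / u)"
      using Q_nonzero[OF r] Q_nonzero[OF u] by (simp add: b_eq add.commute)
  qed
  also have "\<dots> = cnj (KQ a b)" by (simp add: cnj_KQ)
  finally have "Im (KQ a b) = 0" by (simp add: complex_eq_iff)
  then show ?thesis by simp
qed

end

section \<open>The main theorem\<close>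

context prime_field3
begin

lemma prime_p: "prime p"
  using prime_CHAR_semidom[where 'a = 'f] CHAR_pos CHAR_p by simp

text \<open>The field \<open>'f\<close> embeds in its algebraic closure with image
  \<open>Fq 1\<close>. As \<open>psi\<close> depends only on an integer that represents the element,
  it is compatible with the embedding, and \<open>kl_bound\<close> carries over.\<close>

lemma kloosterman_bound:
  fixes a b :: 'f
  assumes "a \<noteq> 0" "b \<noteq> 0"
  shows "norm (\<Sum>u\<in>UNIV - {0}. psi (a * u + b / u)) \<le> 2 * sqrt (real p)"
proof -
  interpret L: closed_field_char p "TYPE('f alg_closure)"
    by unfold_locales (simp_all add: prime_p CHAR_p)
  have range: "L.Fq 1 = range (to_ac :: 'f \<Rightarrow> _)"
  proof
    show "L.Fq 1 \<subseteq> range (to_ac :: 'f \<Rightarrow> _)"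
      unfolding L.Fq1_eq by (metis image_subsetI rangeI to_ac_of_int)
    show "range (to_ac :: 'f \<Rightarrow> _) \<subseteq> L.Fq 1"
      unfolding L.Fq1_eq using ex_of_int by (metis image_subsetI rangeI to_ac_of_int)
  qed
  have psi_ac: "psi (to_ac x) = psi x" for x :: 'f
  proof -
    obtain k where k: "x = of_int k" using ex_of_int by metis
    show ?thesis unfolding k to_ac_of_int psi_int
      using psi_of_int[where 'a = "'f alg_closure", of k] L.CHAR_pos L.CHAR_p by simp
  qed
  have inj: "inj_on (to_ac :: 'f \<Rightarrow> _) (UNIV - {0})"
    using inj_to_ac by (rule inj_on_subset) simp
  have "L.Fq 1 - {0} = to_ac ` (UNIV - {0 :: 'f})"
    unfolding range by auto
  then have "L.kl 1 (to_ac a) (to_ac b) = (\<Sum>u\<in>UNIV - {0}. psi (L.Tr 1 (to_ac (a * u + b / u))))"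
    unfolding L.kl_def by (simp add: sum.reindex[OF inj])
  also have "\<dots> = (\<Sum>u\<in>UNIV - {0}. psi (a * u + b / u))"
    by (simp add: L.Tr_def psi_ac del: to_ac_add to_ac_mult to_ac_divide)
  finally show ?thesis
    using L.kl_bound[of "to_ac a" "to_ac b"] assms range by auto
qed

lemma Re_KQ_bound:
  assumes "a \<noteq> 0" "b \<noteq> 0"
  shows "\<bar>Re (KQ a b)\<bar> \<le> sqrt (real p)"
proof -
  have "norm (KQ a b + cnj (KQ a b)) \<le> 2 * sqrt (real p)"
    unfolding KQ_plus_cnj by (rule kloosterman_bound[OF assms])
  then show ?thesis by (simp add: complex_add_cnj norm_mult)
qed

section \<open>From integers modulo p to the field\<close>

lemma of_int_eq_0: "(of_int k :: 'f) = 0 \<longleftrightarrow> int p dvd k"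
  using of_int_eq_iff_cong_CHAR[where 'a = 'f, of k 0] CHAR_p by (simp add: cong_0_iff)

lemma of_int_in_Q: "of_int u \<in> Q \<longleftrightarrow> [u ^ d = 1] (mod int p)"
  using of_int_eq_iff_cong_CHAR[where 'a = 'f, of "u ^ d" 1] CHAR_p by (simp add: Q_def)

text \<open>Reduction modulo p maps the representatives bijectively onto \<open>Q\<close> and turns
  \<open>modular_inverse\<close> into division.\<close>

lemma K_eq_KQ: "K a b p d = KQ (of_int a) (of_int b)"
proof -
  define U where "U = {u \<in> {0..<int p}. coprime u (int p) \<and> [u ^ d = 1] (mod int p)}"
  have copr: "coprime u (int p)" if "(of_int u :: 'f) \<in> Q" for u
  proof -
    have "\<not> int p dvd u" using Q_nonzero[OF that] of_int_eq_0 by simp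
    then have "coprime (int p) u" using prime_p by (intro prime_imp_coprime) simp_all
    then show ?thesis by (simp only: coprime_commute)
  qed
  have U: "U = {u \<in> {0..<int p}. (of_int u :: 'f) \<in> Q}"
    unfolding U_def of_int_in_Q[symmetric] using copr by auto
  have "bij_betw (of_int :: int \<Rightarrow> 'f) U Q"
  proof (rule bij_betw_subset[OF bij_of_int])
    show "of_int ` U = Q"
    proof (intro subset_antisym subsetI)
      fix x assume x: "x \<in> Q"
      have "x \<in> of_int ` {0..<int p}" unfolding bij_betw_imp_surj_on[OF bij_of_int] by simp
      then obtain u where "u \<in> {0..<int p}" "x = of_int u" by blast
      with x show "x \<in> of_int ` U" unfolding U by blast
    qed (auto simp: U)
  qed (auto simp: U)
  then have "KQ (of_int a) (of_int b) = (\<Sum>u\<in>U. psi (of_int a * of_int u + of_int b / of_int u :: 'f))"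
    unfolding KQ_def by (rule sum.reindex_bij_betw[symmetric])
  also have "\<dots> = (\<Sum>u\<in>U. e (real_of_int (a * u + b * modular_inverse (int p) u) / real p))"
  proof (rule sum.cong)
    fix u assume u: "u \<in> U"
    then have "[u * modular_inverse (int p) u = 1] (mod int p)"
      unfolding U_def by (intro cong_modular_inverse1) auto
    then have "of_int (u * modular_inverse (int p) u) = (of_int 1 :: 'f)"
      unfolding of_int_eq_iff_cong_CHAR CHAR_p .
    then have inv: "of_int u * of_int (modular_inverse (int p) u) = (1 :: 'f)" by simp
    have "(of_int u :: 'f) \<noteq> 0" using u Q_nonzero unfolding U by auto
    with inv have "of_int a * of_int u + of_int b / of_int u =
        (of_int (a * u + b * modular_inverse (int p) u) :: 'f)"
      by (simp add: nonzero_divide_eq_eq distrib_right mult_ac)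
    then show "psi (of_int a * of_int u + of_int b / of_int u :: 'f) =
        e (real_of_int (a * u + b * modular_inverse (int p) u) / real p)"
      by (simp only: psi_int)
  qed simp
  finally show ?thesis by (simp add: K_def U_def)
qed

text \<open>By Euler's criterion the image of the symbol in the field is b^d; as 1 and -1 differ
  there, the image determines the symbol.\<close>

lemma Legendre_eq_chi:
  assumes "\<not> int p dvd b"
  shows "of_int (Legendre b (int p)) = chi (of_int b)"
proof -
  have "p \<noteq> 2" "p \<ge> 2" using p_mod prime_p by (auto dest: prime_ge_2_nat)
  then have "[Legendre b (int p) = b ^ d] (mod int p)"
    unfolding d_def by (intro euler_criterion) (use prime_p in auto)
  then have "(of_int (Legendre b (int p)) :: 'f) = of_int (b ^ d)"
    unfolding of_int_eq_iff_cong_CHAR CHAR_p .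
  then have *: "(of_int b :: 'f) ^ d = of_int (Legendre b (int p))" by simp
  have nz: "(of_int b :: 'f) \<noteq> 0" using assms by (simp add: of_int_eq_0)
  have "Legendre b (int p) = 1 \<or> Legendre b (int p) = -1"
    using assms by (auto simp: Legendre_def cong_0_iff)
  then show ?thesis using * nz one_neq_minus_one by (auto simp: chi_def Q_def)
qed

lemma KQ_0_0: "KQ 0 0 = (of_nat p - 1) / 2"
proof -
  have "KQ 0 0 + cnj (KQ 0 0) = of_nat (card (UNIV - {0 :: 'f}))"
    unfolding KQ_plus_cnj by (simp add: psi_0)
  also have "card (UNIV - {0 :: 'f}) = p - 1"
    using CARD_p by (simp add: card_Diff_singleton)
  finally have "2 * KQ 0 0 = of_nat (p - 1)" by (simp add: cnj_KQ)
  then show ?thesis using p_pos by (simp add: of_nat_diff Suc_leI field_simps)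
qed

end

text \<open>The claim for a single triple is named so that its failure can serve in the choice of
  one prime.\<close>

definition theorem4_at :: "nat \<Rightarrow> int \<Rightarrow> int \<Rightarrow> bool" where
  "theorem4_at p a b \<longleftrightarrow>
     (\<not> int p dvd a * b \<longrightarrow>
        \<bar>Re (K a b p ((p - 1) div 2))\<bar> \<le> sqrt (real p) \<and>
        \<bar>Im (K a b p ((p - 1) div 2))\<bar> \<le> sqrt (real p)) \<and>
     ([a = 0] (mod int p) \<and> \<not> int p dvd b \<longrightarrow>
        K a b p ((p - 1) div 2) =
          1 / 2 * (of_int (Legendre b (int p)) * \<i> * of_real (sqrt (real p)) - 1)) \<and>
     ([a = 0] (mod int p) \<and> [b = 0] (mod int p) \<longrightarrow>
        K a b p ((p - 1) div 2) = (of_nat p - 1) / 2)"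

lemma (in prime_field3) theorem4_at: "theorem4_at p a b"
proof -
  have zero: "(of_int k :: 'f) = 0" if "[k = 0] (mod int p)" for k
    using that by (simp add: of_int_eq_0 cong_0_iff)
  have 1: "\<bar>Re (KQ (of_int a) (of_int b))\<bar> \<le> sqrt (real p) \<and>
           \<bar>Im (KQ (of_int a) (of_int b))\<bar> \<le> sqrt (real p)" if "\<not> int p dvd a * b"
  proof -
    from that have "(of_int a :: 'f) \<noteq> 0" "(of_int b :: 'f) \<noteq> 0" by (auto simp: of_int_eq_0)
    then show ?thesis by (intro conjI Re_KQ_bound Im_KQ_bound)
  qed
  have 2: "KQ (of_int a) (of_int b) =
      1 / 2 * (of_int (Legendre b (int p)) * \<i> * of_real (sqrt (real p)) - 1)"
    if "[a = 0] (mod int p)" "\<not> int p dvd b"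
    unfolding zero[OF that(1)] Legendre_eq_chi[OF that(2)]
    by (rule KQ_left_0) (simp add: of_int_eq_0 that(2))
  have 3: "KQ (of_int a) (of_int b) = (of_nat p - 1) / 2"
    if "[a = 0] (mod int p)" "[b = 0] (mod int p)"
    unfolding zero[OF that(1)] zero[OF that(2)] by (rule KQ_0_0)
  show ?thesis
    unfolding theorem4_at_def d_def[symmetric] K_eq_KQ using 1 2 3 by blast
qed

text \<open>
  A type cannot depend on the variable p. The finite field is therefore built for one fixed prime,
  chosen to be a counterexample if there is any.
\<close>
definition p0 :: nat where
  "p0 = (if \<exists>p a b. prime p \<and> [p = 3] (mod 4) \<and> \<not> theorem4_at p a b
         then SOME p. prime p \<and> [p = 3] (mod 4) \<and> (\<exists>a b. \<not> theorem4_at p a b) else 3)"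

lemma p0_counterexample:
  assumes "prime p" "[p = 3] (mod 4)" "\<not> theorem4_at p a b"
  shows "prime p0 \<and> [p0 = 3] (mod 4) \<and> (\<exists>a b. \<not> theorem4_at p0 a b)"
proof -
  have ex: "\<exists>p a b. prime p \<and> [p = 3] (mod 4) \<and> \<not> theorem4_at p a b" using assms by blast
  then have "\<exists>p. prime p \<and> [p = 3] (mod 4) \<and> (\<exists>a b. \<not> theorem4_at p a b)" by blast
  from someI_ex[OF this] show ?thesis unfolding p0_def using ex by simp
qed

text \<open>The fallback 3 is itself a prime congruent to 3 modulo 4, so both facts hold
  unconditionally and the type can be built before the theorem is known.\<close>

lemma prime_p0: "prime p0" and p0_cong: "[p0 = 3] (mod 4)"
proof -
  have "prime p0 \<and> [p0 = 3] (mod 4)"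
  proof (cases "\<exists>p a b. prime p \<and> [p = 3] (mod 4) \<and> \<not> theorem4_at p a b")
    case True
    then show ?thesis using p0_counterexample by blast
  next
    case False
    then have "p0 = 3" by (simp only: p0_def if_False)
    moreover have "prime (3 :: nat)"
      by (rule prime_nat_numeral_eq[THEN iffD2]) auto
    ultimately show ?thesis by simp
  qed
  then show "prime p0" "[p0 = 3] (mod 4)" by auto
qed

typedef p0_index = "{..<p0}"
  using prime_gt_0_nat[OF prime_p0] by auto

lemma card_p0_index: "CARD(p0_index) = p0"
  using type_definition.card[OF type_definition_p0_index] by simp

instance p0_index :: prime_card
  by standard (simp add: card_p0_index prime_p0)

interpretation p0: prime_field3 p0 "TYPE(p0_index mod_ring)"
proof
  show "p0 mod 4 = 3" using p0_cong by (simp add: cong_def)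
qed (simp_all add: card_p0_index)

theorem theorem4:
  fixes p :: nat and a b :: int
  assumes "prime p" and "[p = 3] (mod 4)"
  shows "(\<not> int p dvd a * b \<longrightarrow>
            \<bar>Re (K a b p ((p - 1) div 2))\<bar> \<le> sqrt (real p) \<and>
            \<bar>Im (K a b p ((p - 1) div 2))\<bar> \<le> sqrt (real p)) \<and>
         ([a = 0] (mod int p) \<and> \<not> int p dvd b \<longrightarrow>
            K a b p ((p - 1) div 2) =
              1 / 2 * (of_int (Legendre b (int p)) * \<i> * of_real (sqrt (real p)) - 1)) \<and>
         ([a = 0] (mod int p) \<and> [b = 0] (mod int p) \<longrightarrow>
            K a b p ((p - 1) div 2) = (of_nat p - 1) / 2)"
proof -
  have "theorem4_at p a b"
    using p0_counterexample[OF assms] p0.theorem4_at by blast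
  then show ?thesis unfolding theorem4_at_def .
qed

end
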